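(* Let $P=\operatorname{diag}\{P_1,\dots,P_\nu\}$, where each $P_i$ has $m$ inputs and $p$ outputs, let $K_{\mathrm e}=\operatorname{diag}\{K_{\mathrm e,1},\dots,K_{\mathrm e,\mu}\}$ with $m\times p$ blocks, and let $K=(E\otimes I_m)K_{\mathrm e}(E^\top\otimes I_p)$, where $E$ is the incidence matrix of a graph with $\nu$ nodes and $\mu$ edges. Suppose $P(s)$ and $K_{\mathrm e}(s)$ are real rational and proper, and let $\lambda\in\bar{\mathbb C}_0$ be a pole of $P(s)$. (i) If $\bigcap_{i=1}^\nu\mathrm{pdir_i}(P_i,\lambda)\ne\{0\}$, then $\lambda$ is canceled in $P(s)K(s)$. (ii) If $\bigcap_{i=1}^\nu\mathrm{pdir_o}(P_i,\lambda)\ne\{0\}$, then $\lambda$ is canceled in $K(s)P(s)$.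
   Context: **Notation.** $\bar{\mathbb C}_0=\{s\in\mathbb C:\operatorname{Re}s\ge0\}$. $A^\top$ denotes the complex-conjugate transpose of a matrix $A$; $\otimes$ is the Kronecker product. **Incidence matrix.** For a graph with $\nu$ vertices and $\mu$ (oriented) edges, $E\in\mathbb R^{\nu\times\mu}$ has $(i,j)$ entry $1$ if vertex $i$ is the head of edge $j$, $-1$ if vertex $i$ is the tail of edge $j$, and $0$ if vertex $i$ does not belong to edge $j$ (so $\mathbb 1^\top E=0$ with $\mathbb 1$ the all-ones vector). **Poles.** The poles of a proper rational transfer function $G(s)$, counted with multiplicities, are the eigenvalues (with algebraic multiplicities) of $A$ in any minimal state-space realization $G(s)=D+C(sI-A)^{-1}B$; a point that is not a pole has multiplicity $0$. **Pole directions.** With $(A,B,C,D)$ a minimal realization of the $p\times m$ transfer function $G$, the input and output directions of $\lambda\in\mathbb C$ are $$\mathrm{pdir_i}(G,\lambda)=B^\top\ker(\lambda I-A)^\top\subset\mathbb C^m,\qquad\mathrm{pdir_o}(G,\lambda)=C\ker(\lambda I-A)\subset\mathbb C^p.$$ They do not depend on the choice of minimal realization, and equal $\{0\}$ if $\lambda$ is not a pole of $G$. **Cancellation.** A pole $\lambda$ of $G_1(s)$ and/or $G_2(s)$ is said to be *canceled* in the cascade $G_2(s)G_1(s)$ if its multiplicity as a pole of $G_2(s)G_1(s)$ is strictly smaller than the sum of its multiplicities as a pole of $G_1(s)$ and of $G_2(s)$. *)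

theory Defs
  imports
    "HOL-Computational_Algebra.Fraction_Field"
    "HOL-Computational_Algebra.Polynomial"
    "Jordan_Normal_Form.Char_Poly"
    "Jordan_Normal_Form.Matrix_Kernel"
    "Jordan_Normal_Form.Schur_Decomposition"
    "Graph_Theory.Digraph"
begin

text \<open>
  A rational transfer function is a matrix over the field of complex rational functions in
  the indeterminate s. Realness and properness are explicit predicates.
\<close>

type_synonym tf = "complex poly fract mat"

definition rat_const :: "complex \<Rightarrow> complex poly fract" where
  "rat_const c = Fract [:c:] 1"

definition rat_s :: "complex poly fract" where
  "rat_s = Fract [:0, 1:] 1"

definition tf_const :: "complex mat \<Rightarrow> tf" where
  "tf_const = map_mat rat_const"

definition real_rational :: "complex poly fract \<Rightarrow> bool" where
  "real_rational q \<longleftrightarrow> (\<exists>a b :: real poly. b \<noteq> 0 \<and>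
     q = Fract (map_poly complex_of_real a) (map_poly complex_of_real b))"

definition proper_rational :: "complex poly fract \<Rightarrow> bool" where
  "proper_rational q \<longleftrightarrow> (\<exists>a b. b \<noteq> 0 \<and> degree a \<le> degree b \<and> q = Fract a b)"

definition tf_real :: "tf \<Rightarrow> bool" where
  "tf_real G \<longleftrightarrow> (\<forall>q \<in> elements_mat G. real_rational q)"

definition tf_proper :: "tf \<Rightarrow> bool" where
  "tf_proper G \<longleftrightarrow> (\<forall>q \<in> elements_mat G. proper_rational q)"

text \<open>
  In the next definition R is the inverse of s I - A over the field of rational functions.
  State dimension 0 is allowed.
\<close>

definition realization ::
  "tf \<Rightarrow> complex mat \<Rightarrow> complex mat \<Rightarrow> complex mat \<Rightarrow> complex mat \<Rightarrow> bool" where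
  "realization G A B C D \<longleftrightarrow>
     (let n = dim_row A; sIA = rat_s \<cdot>\<^sub>m 1\<^sub>m n - tf_const A in
        A \<in> carrier_mat n n \<and>
        B \<in> carrier_mat n (dim_col G) \<and>
        C \<in> carrier_mat (dim_row G) n \<and>
        D \<in> carrier_mat (dim_row G) (dim_col G) \<and>
        (\<exists>R \<in> carrier_mat n n. inverts_mat sIA R \<and> inverts_mat R sIA \<and>
           G = tf_const D + tf_const C * R * tf_const B))"

definition minimal_realization ::
  "tf \<Rightarrow> complex mat \<Rightarrow> complex mat \<Rightarrow> complex mat \<Rightarrow> complex mat \<Rightarrow> bool" where
  "minimal_realization G A B C D \<longleftrightarrow> realization G A B C D \<and>
     (\<forall>A' B' C' D'. realization G A' B' C' D' \<longrightarrow> dim_row A \<le> dim_row A')"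

text \<open>
  The notions below are read off from one arbitrarily chosen minimal realization. Every proper G
  has one, and any two differ by a change of basis of the state space, so the choice is immaterial.
\<close>

definition min_real :: "tf \<Rightarrow> complex mat \<times> complex mat \<times> complex mat \<times> complex mat" where
  "min_real G = (SOME (A, B, C, D). minimal_realization G A B C D)"

definition tf_pole :: "tf \<Rightarrow> complex \<Rightarrow> bool" where
  "tf_pole G z = (case min_real G of (A, B, C, D) \<Rightarrow> eigenvalue A z)"

definition pole_mult :: "tf \<Rightarrow> complex \<Rightarrow> nat" where
  "pole_mult G z = (case min_real G of (A, B, C, D) \<Rightarrow> order z (char_poly A))"

definition pdir_i :: "tf \<Rightarrow> complex \<Rightarrow> complex vec set" where
  "pdir_i G z = (case min_real G of (A, B, C, D) \<Rightarrow>
     (\<lambda>v. mat_adjoint B *\<^sub>v v) ` mat_kernel (mat_adjoint (z \<cdot>\<^sub>m 1\<^sub>m (dim_row A) - A)))"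

definition pdir_o :: "tf \<Rightarrow> complex \<Rightarrow> complex vec set" where
  "pdir_o G z = (case min_real G of (A, B, C, D) \<Rightarrow>
     (\<lambda>v. C *\<^sub>v v) ` mat_kernel (z \<cdot>\<^sub>m 1\<^sub>m (dim_row A) - A))"

text \<open>
  \<open>canceled z G2 G1\<close> refers to the cascade \<open>G2 * G1\<close>, with \<open>G1\<close> acting first.
\<close>

definition canceled :: "complex \<Rightarrow> tf \<Rightarrow> tf \<Rightarrow> bool" where
  "canceled z G2 G1 \<longleftrightarrow> (tf_pole G1 z \<or> tf_pole G2 z) \<and>
     pole_mult (G2 * G1) z < pole_mult G1 z + pole_mult G2 z"

definition kronecker_mat :: "'a :: semiring_0 mat \<Rightarrow> 'a mat \<Rightarrow> 'a mat" (infixl "\<otimes>\<^sub>K" 70) where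
  "X \<otimes>\<^sub>K Y = mat (dim_row X * dim_row Y) (dim_col X * dim_col Y)
     (\<lambda>(i, j). X $$ (i div dim_row Y, j div dim_col Y) * Y $$ (i mod dim_row Y, j mod dim_col Y))"

text \<open>
  Vertices are numbered 0, ..., nv - 1 and arcs 0, ..., ne - 1; the graph is meant to be
  loop-free, so that no vertex is both head and tail of an arc.
\<close>

definition incidence_mat :: "(nat, nat) pre_digraph \<Rightarrow> nat \<Rightarrow> nat \<Rightarrow> real mat" where
  "incidence_mat \<G> nv ne = mat nv ne
     (\<lambda>(i, j). if i = head \<G> j then 1 else if i = tail \<G> j then - 1 else 0)"

end

theory Submission
  imports Defs
begin

text \<open>
  If every agent has the direction \<open>w\<close> at \<open>\<lambda>\<close>, then \<open>1 \<otimes> w\<close> is an input direction of \<open>P\<close>: there is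
  \<open>y\<close> with \<open>A\<^sup>T y = \<lambda> y\<close> and \<open>B\<^sup>T y = 1 \<otimes> w\<close>. The columns of \<open>E\<close> sum to zero, so \<open>(1 \<otimes> w)\<^sup>T K = 0\<close>,
  and by controllability of a minimal realization of \<open>K\<close> its output matrices are annihilated as well.
  Hence \<open>(y, 0)\<close> is an uncontrollable left eigenvector of the cascade realization of \<open>P K\<close>. Removing
  this mode leaves a realization whose characteristic polynomial has lost a factor \<open>s - \<lambda>\<close>, and the
  pole multiplicities of any realization bound those of a minimal one. The second claim is the first
  one for the transposed systems.

  Everything about minimality rests on one fact: a realization that is controllable and observable
  in the eigenvector sense has injective observability and controllability matrices, and comparing
  Hankel matrices shows that it is similar to every minimal realization.
\<close>

text \<open>Poles and directions are read from a realization picked by \<open>SOME\<close>, so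
  nothing is known of them before a realization is known to exist; this is why every proper matrix
  has to be realized, by partial fractions over the complex numbers. Multiplicities then become
  independent of the choice: any realization that passes the eigenvector tests may replace the
  chosen one. That freedom is essential, because the realization of \<open>P\<close> is assembled
  block by block from those of the agents, and it passes the tests even though the agents share the
  pole. Markov parameters are obtained without power series: multiplying an equality of outputs by s
  and using the state equation splits off a constant, and growth at infinity separates this constant
  from the strictly proper rest. Duality uses plain transposes. An adjoint would also conjugate the
  pole; conjugating an input direction once turns the adjoint into a transpose and keeps \<lambda>
  fixed.\<close>

section \<open>Matrix identities under dimension equations, kernels and one-sided inverses\<close>

lemma mult_assoc_mat:
  fixes A B C :: "'a :: semiring_0 mat"
  assumes "dim_col A = dim_row B" "dim_col B = dim_row C"
  shows "A * B * C = A * (B * C)"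
  by (rule assoc_mult_mat[of A "dim_row A" "dim_row B" B "dim_row C" C "dim_col C"])
    (use assms in auto)

lemma mult_assoc_mat_vec:
  fixes A B :: "'a :: semiring_0 mat"
  assumes "dim_col A = dim_row B" "dim_col B = dim_vec v"
  shows "A * B *\<^sub>v v = A *\<^sub>v (B *\<^sub>v v)"
  by (rule assoc_mult_mat_vec[of A "dim_row A" "dim_row B" B "dim_vec v"])
    (use assms in auto)

lemma mult_add_mat:
  fixes A B C :: "'a :: semiring_0 mat"
  assumes "dim_col A = dim_row B" "dim_row B = dim_row C" "dim_col B = dim_col C"
  shows "A * (B + C) = A * B + A * C"
  by (rule mult_add_distrib_mat[of A "dim_row A" "dim_row B" B "dim_col B" C])
    (use assms in auto)

lemma add_mult_mat:
  fixes A B C :: "'a :: semiring_0 mat"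
  assumes "dim_col A = dim_row C" "dim_row A = dim_row B" "dim_col A = dim_col B"
  shows "(A + B) * C = A * C + B * C"
  by (rule add_mult_distrib_mat[of A "dim_row A" "dim_col A" B C "dim_col C"])
    (use assms in auto)

lemma mult_smult_mat:
  fixes A B :: "'a :: comm_semiring_0 mat"
  assumes "dim_col A = dim_row B"
  shows "A * (k \<cdot>\<^sub>m B) = k \<cdot>\<^sub>m (A * B)"
  by (rule mult_smult_distrib[of A "dim_row A" "dim_row B" B "dim_col B"])
    (use assms in auto)

lemma smult_mult_mat:
  fixes A B :: "'a :: comm_semiring_0 mat"
  assumes "dim_col A = dim_row B"
  shows "(k \<cdot>\<^sub>m A) * B = k \<cdot>\<^sub>m (A * B)"
  by (rule mult_smult_assoc_mat[of A "dim_row A" "dim_row B" B "dim_col B"])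
    (use assms in auto)

lemma transpose_mult_mat:
  fixes A B :: "'a :: comm_semiring_0 mat"
  assumes "dim_col A = dim_row B"
  shows "transpose_mat (A * B) = transpose_mat B * transpose_mat A"
  by (rule transpose_mult[of A "dim_row A" "dim_row B" B "dim_col B"]) (use assms in auto)

lemma inverse_mat_obtain:
  fixes A :: "'a :: field mat"
  assumes A: "A \<in> carrier_mat n n" and "det A \<noteq> 0"
  obtains B where "B \<in> carrier_mat n n" "A * B = 1\<^sub>m n" "B * A = 1\<^sub>m n"
  using det_non_zero_imp_unit[OF assms, of "()"]
  by (auto simp: Units_def ring_mat_def)

text \<open>Padding with zero rows gives a square matrix whose last row is zero. Its determinant
  vanishes, and its kernel vectors are kernel vectors of \<open>M\<close>.\<close>

lemma wide_mat_kernel: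
  fixes M :: "'a :: field mat"
  assumes M: "M \<in> carrier_mat r c" and rc: "r < c"
  obtains v where "v \<in> carrier_vec c" "v \<noteq> 0\<^sub>v c" "M *\<^sub>v v = 0\<^sub>v r"
proof -
  define M' where "M' = mat c c (\<lambda>(i,j). if i < r then M $$ (i,j) else 0)"
  have M': "M' \<in> carrier_mat c c" by (simp add: M'_def)
  have "row M' (c - 1) = 0\<^sub>v c"
    using rc by (intro eq_vecI) (auto simp: M'_def row_def)
  hence "det M' = 0"
  proof -
    have "M' = mat\<^sub>r c c (\<lambda>i. if i = c - 1 then 0\<^sub>v c else row M' i)"
      using rc M' \<open>row M' (c - 1) = 0\<^sub>v c\<close>
      by (intro eq_rowI) auto
    thus ?thesis
      using det_row_0[of "c - 1" c "row M'"] rc M' by (metis (no_types, lifting) Pi_I diff_less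
        gr_implies_not0 less_one linorder_neqE_nat row_carrier_vec atLeastLessThan_iff)
  qed
  then obtain v where v: "v \<in> carrier_vec c" "v \<noteq> 0\<^sub>v c" "M' *\<^sub>v v = 0\<^sub>v c"
    using det_0_iff_vec_prod_zero_field[OF M'] by auto
  have "M *\<^sub>v v = 0\<^sub>v r"
  proof (rule eq_vecI)
    fix i assume "i < dim_vec (0\<^sub>v r :: 'a vec)"
    hence i: "i < r" by simp
    have "row M i = row M' i"
      using i rc M by (intro eq_vecI) (auto simp: M'_def)
    hence "(M *\<^sub>v v) $ i = (M' *\<^sub>v v) $ i" using i rc M M' by simp
    thus "(M *\<^sub>v v) $ i = 0\<^sub>v r $ i" using i rc v by simp
  qed (use M in auto)
  with v that show thesis by blast
qed

text \<open>\<open>T\<close> has the left inverse \<open>S\<close>, hence a trivial kernel, so it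
  cannot be wide. Applied to a pair intertwining two realizations, this compares their state
  dimensions.\<close>

lemma left_inverse_mat_dim_le:
  fixes S :: "'a :: field mat"
  assumes S: "S \<in> carrier_mat n k" and T: "T \<in> carrier_mat k n" and ST: "S * T = 1\<^sub>m n"
  shows "n \<le> k"
proof (rule ccontr)
  assume "\<not> n \<le> k"
  then obtain v where v: "v \<in> carrier_vec n" "v \<noteq> 0\<^sub>v n" "T *\<^sub>v v = 0\<^sub>v k"
    using wide_mat_kernel[OF T] by (metis not_le)
  have "v = S * T *\<^sub>v v" using v ST by simp
  also have "\<dots> = S *\<^sub>v (T *\<^sub>v v)" using S T v by simp
  also have "\<dots> = 0\<^sub>v n" using v S by (auto intro!: eq_vecI)
  finally show False using v by simp
qed

text \<open>The left inverse is \<open>(M\<^sup>* M)\<^sup>-\<^sup>1 M\<^sup>*\<close>.\<close>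

lemma complex_mat_left_inverse:
  fixes M :: "complex mat"
  assumes M: "M \<in> carrier_mat k n"
    and inj: "\<And>v. v \<in> carrier_vec n \<Longrightarrow> M *\<^sub>v v = 0\<^sub>v k \<Longrightarrow> v = 0\<^sub>v n"
  obtains L where "L \<in> carrier_mat n k" "L * M = 1\<^sub>m n"
proof -
  define H where "H = map_mat cnj (transpose_mat M)"
  have H: "H \<in> carrier_mat n k" using M by (simp add: H_def)
  have "det (H * M) \<noteq> 0"
  proof
    assume "det (H * M) = 0"
    moreover have "H * M \<in> carrier_mat n n" using H M by simp
    ultimately obtain v where v: "v \<in> carrier_vec n" "v \<noteq> 0\<^sub>v n" "H * M *\<^sub>v v = 0\<^sub>v n"
      using det_0_iff_vec_prod_zero_field by blast
    define u where "u = M *\<^sub>v v"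
    have u: "u \<in> carrier_vec k" using M v by (simp add: u_def)
    have Hu: "H *\<^sub>v u = 0\<^sub>v n" using v H M by (simp add: u_def)
    \<comment> \<open>In coordinates, this chain computes the squared norm of \<open>u = M v\<close>
      as the inner product of \<open>M^* u\<close> with \<open>v\<close>, which is zero; so a kernel
      vector of the Gram matrix \<open>H * M\<close> is already one of \<open>M\<close>.\<close>
    have "(\<Sum>i<k. u $ i * cnj (u $ i)) = (\<Sum>i<k. \<Sum>j<n. u $ i * (H $$ (j,i) * cnj (v $ j)))"
    proof (rule sum.cong[OF refl])
      fix i assume "i \<in> {..<k}"
      hence "u $ i = (\<Sum>j<n. M $$ (i,j) * v $ j)"
        using M v by (simp add: u_def scalar_prod_def atLeast0LessThan)
      hence "cnj (u $ i) = (\<Sum>j<n. H $$ (j,i) * cnj (v $ j))"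
        using M \<open>i \<in> {..<k}\<close> by (simp add: H_def)
      thus "u $ i * cnj (u $ i) = (\<Sum>j<n. u $ i * (H $$ (j,i) * cnj (v $ j)))"
        by (simp add: sum_distrib_left)
    qed
    also have "\<dots> = (\<Sum>j<n. cnj (v $ j) * (\<Sum>i<k. H $$ (j,i) * u $ i))"
      by (subst sum.swap) (simp add: sum_distrib_left mult_ac)
    also have "\<dots> = (\<Sum>j<n. cnj (v $ j) * (H *\<^sub>v u) $ j)"
      using H u by (intro sum.cong) (auto simp: scalar_prod_def atLeast0LessThan)
    also have "\<dots> = 0" using Hu by simp
    finally have "u \<bullet>c u = 0" using u by (simp add: scalar_prod_def atLeast0LessThan)
    hence "u = 0\<^sub>v k" using u by simp
    thus False using inj[of v] v by (simp add: u_def)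
  qed
  moreover have "H * M \<in> carrier_mat n n" using H M by simp
  ultimately obtain W where W: "W \<in> carrier_mat n n" "W * (H * M) = 1\<^sub>m n"
    using inverse_mat_obtain by metis
  show thesis
    by (rule that[of "W * H"]) (use W H M in auto)
qed

section \<open>Constant matrices inside the field of rational functions\<close>

lemma rat_const_simps [simp]: "rat_const 0 = 0" "rat_const 1 = 1"
  by (simp_all add: rat_const_def Zero_fract_def One_fract_def one_pCons)

interpretation rat_const: comm_ring_hom rat_const
  by unfold_locales
    (simp_all add: rat_const_def Zero_fract_def One_fract_def one_pCons mult.commute)

lemma rat_s_nonzero: "rat_s \<noteq> 0"
  by (simp add: rat_s_def Zero_fract_def eq_fract)

lemma tf_const_dim [simp]:
  "dim_row (tf_const A) = dim_row A" "dim_col (tf_const A) = dim_col A"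
  by (simp_all add: tf_const_def)

lemma tf_const_carrier [simp]: "tf_const A \<in> carrier_mat r c \<longleftrightarrow> A \<in> carrier_mat r c"
  by (simp add: tf_const_def)

lemma tf_const_index [simp]:
  "i < dim_row A \<Longrightarrow> j < dim_col A \<Longrightarrow> tf_const A $$ (i,j) = rat_const (A $$ (i,j))"
  by (simp add: tf_const_def)

lemma tf_const_mult:
  "dim_col A = dim_row B \<Longrightarrow> tf_const (A * B) = tf_const A * tf_const B"
  unfolding tf_const_def
  by (rule rat_const.mat_hom_mult[of A "dim_row A" "dim_row B" B "dim_col B"]) auto

lemma tf_const_transpose: "tf_const (transpose_mat A) = transpose_mat (tf_const A)"
  by (auto simp: tf_const_def)

lemma tf_const_zero [simp]: "tf_const (0\<^sub>m r c) = 0\<^sub>m r c"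
  by (auto simp: tf_const_def)

lemma tf_const_one [simp]: "tf_const (1\<^sub>m n) = 1\<^sub>m n"
  by (auto simp: tf_const_def)

subsection \<open>Growth at infinity\<close>

text \<open>The bound is an integer so that decay can be expressed: \<open>d = -1\<close> is strict
  properness. Quantifying over representations avoids reduced fractions.\<close>

definition deg_le :: "complex poly fract \<Rightarrow> int \<Rightarrow> bool" where
  "deg_le q d \<longleftrightarrow> (\<exists>a b. b \<noteq> 0 \<and> q = Fract a b \<and> int (degree a) \<le> int (degree b) + d)"

lemma deg_le_mono: "deg_le q d \<Longrightarrow> d \<le> e \<Longrightarrow> deg_le q e"
  unfolding deg_le_def by force

lemma deg_le_bound: "\<exists>d::nat. deg_le q (int d)"
proof (cases q)
  case (Fract a b)
  show ?thesis unfolding deg_le_def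
    by (rule exI[of _ "degree a"], rule exI[of _ a], rule exI[of _ b]) (use Fract in auto)
qed

text \<open>The zero polynomial has \<open>degree\<close> 0, so a negative \<open>d\<close> calls
  for a denominator of degree at least \<open>- d\<close>; zero admits every nonzero
  denominator.\<close>

lemma deg_le_0: "deg_le 0 d"
  unfolding deg_le_def
  by (rule exI[of _ 0], rule exI[of _ "monom 1 (nat \<bar>d\<bar>)"])
    (auto simp: Zero_fract_def eq_fract degree_monom_eq monom_eq_0_iff)

lemma deg_le_rat_const: "0 \<le> d \<Longrightarrow> deg_le (rat_const c) d"
  unfolding deg_le_def rat_const_def
  by (rule exI[of _ "[:c:]"], rule exI[of _ 1]) auto

lemma deg_le_add:
  assumes "deg_le p d" "deg_le q d"
  shows "deg_le (p + q) d"
proof -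
  obtain a b a' b' where *: "b \<noteq> 0" "p = Fract a b" "int (degree a) \<le> int (degree b) + d"
    "b' \<noteq> 0" "q = Fract a' b'" "int (degree a') \<le> int (degree b') + d"
    using assms unfolding deg_le_def by blast
  have "degree (a * b' + a' * b) \<le> max (degree (a * b')) (degree (a' * b))"
    by (rule degree_add_le_max)
  hence "int (degree (a * b' + a' * b)) \<le> max (int (degree (a * b'))) (int (degree (a' * b)))"
    by linarith
  moreover have "int (degree (a * b')) \<le> int (degree a) + int (degree b')"
    "int (degree (a' * b)) \<le> int (degree a') + int (degree b)"
    using degree_mult_le[of a b'] degree_mult_le[of a' b] by linarith+
  moreover have "int (degree (b * b')) = int (degree b) + int (degree b')"
    using * by (simp add: degree_mult_eq)
  ultimately have "int (degree (a * b' + a' * b)) \<le> int (degree (b * b')) + d"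
    using * by linarith
  thus ?thesis using * unfolding deg_le_def
    by (intro exI[of _ "a * b' + a' * b"] exI[of _ "b * b'"]) simp
qed

lemma deg_le_const_mult:
  assumes "deg_le q d"
  shows "deg_le (rat_const c * q) d"
proof -
  obtain a b where *: "b \<noteq> 0" "q = Fract a b" "int (degree a) \<le> int (degree b) + d"
    using assms unfolding deg_le_def by blast
  have "degree (smult c a) \<le> degree a" by (rule degree_smult_le)
  thus ?thesis using * unfolding deg_le_def
    by (intro exI[of _ "smult c a"] exI[of _ b]) (auto simp: rat_const_def)
qed

lemma deg_le_sum: "(\<And>x. x \<in> S \<Longrightarrow> deg_le (f x) d) \<Longrightarrow> deg_le (sum f S) d"
  by (induction S rule: infinite_finite_induct) (auto simp: deg_le_0 deg_le_add)

lemma deg_le_diff: "deg_le p d \<Longrightarrow> deg_le q d \<Longrightarrow> deg_le (p - q) d"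
  using deg_le_add[of p d "rat_const (-1) * q"] deg_le_const_mult[of q d "-1"]
  by (simp add: rat_const.hom_uminus)

lemma deg_le_div_s:
  assumes "deg_le (rat_s * q) d"
  shows "deg_le q (d - 1)"
proof -
  obtain a b where *: "b \<noteq> 0" "rat_s * q = Fract a b" "int (degree a) \<le> int (degree b) + d"
    using assms unfolding deg_le_def by blast
  have "rat_s * q = rat_s * Fract a ([:0,1:] * b)"
    unfolding *(2) using *(1) by (simp add: rat_s_def eq_fract)
  hence "q = Fract a ([:0,1:] * b)" using rat_s_nonzero by simp
  thus ?thesis using * unfolding deg_le_def
    by (intro exI[of _ a] exI[of _ "[:0,1:] * b"]) (auto simp: degree_mult_eq)
qed

lemma rat_const_strictly_proper: "deg_le (rat_const c) (-1) \<Longrightarrow> c = 0"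
proof (rule ccontr)
  assume c: "c \<noteq> 0" and "deg_le (rat_const c) (-1)"
  then obtain a b where *: "b \<noteq> 0" "rat_const c = Fract a b" "int (degree a) \<le> int (degree b) - 1"
    unfolding deg_le_def by auto
  hence "smult c b = a" by (simp add: rat_const_def eq_fract)
  hence "degree a = degree b" using c by auto
  thus False using * by simp
qed

definition strictly_proper_mat :: "tf \<Rightarrow> bool" where
  "strictly_proper_mat X \<longleftrightarrow> (\<forall>i<dim_row X. \<forall>j<dim_col X. deg_le (X $$ (i,j)) (-1))"

lemma strictly_proper_const_mult:
  assumes "strictly_proper_mat X" "dim_col M = dim_row X"
  shows "strictly_proper_mat (tf_const M * X)"
  unfolding strictly_proper_mat_def
proof (intro allI impI)
  fix i j assume "i < dim_row (tf_const M * X)" "j < dim_col (tf_const M * X)"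
  thus "deg_le ((tf_const M * X) $$ (i,j)) (-1)"
    using assms by (auto simp: scalar_prod_def strictly_proper_mat_def
        intro!: deg_le_sum deg_le_const_mult)
qed

text \<open>\<open>D - D'\<close> equals a difference of strictly proper matrices, and a constant
  that decays at infinity is zero.\<close>

lemma const_plus_strictly_proper_unique:
  assumes eq: "tf_const D + Y = tf_const D' + Y'"
    and sp: "strictly_proper_mat Y" "strictly_proper_mat Y'"
    and dim: "dim_row D = dim_row Y" "dim_col D = dim_col Y" "dim_row Y' = dim_row Y"
      "dim_col Y' = dim_col Y" "dim_row D' = dim_row Y" "dim_col D' = dim_col Y"
  shows "D = D'" "Y = Y'"
proof -
  show D: "D = D'"
  proof (rule eq_matI)
    fix i j assume "i < dim_row D'" "j < dim_col D'"
    hence ij: "i < dim_row Y" "j < dim_col Y" using dim by auto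
    from arg_cong[OF eq, of "\<lambda>M. M $$ (i,j)"] ij dim
    have "rat_const (D $$ (i,j) - D' $$ (i,j)) = Y' $$ (i,j) - Y $$ (i,j)"
      by (simp add: rat_const.hom_minus algebra_simps)
    moreover have "deg_le (Y' $$ (i,j) - Y $$ (i,j)) (-1)"
      using sp ij dim by (intro deg_le_diff) (auto simp: strictly_proper_mat_def)
    ultimately have "deg_le (rat_const (D $$ (i,j) - D' $$ (i,j))) (-1)" by simp
    from rat_const_strictly_proper[OF this] show "D $$ (i,j) = D' $$ (i,j)" by simp
  qed (use dim in auto)
  show "Y = Y'"
  proof (rule eq_matI)
    fix i j assume "i < dim_row Y'" "j < dim_col Y'"
    thus "Y $$ (i,j) = Y' $$ (i,j)"
      using arg_cong[OF eq, of "\<lambda>M. M $$ (i,j)"] D dim by simp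
  qed (use dim in auto)
qed

subsection \<open>Realizations as solutions of the state equation\<close>

text \<open>\<open>solves A B X\<close> is the Laplace-domain state equation \<open>s X = A X + B\<close>, that is
  \<open>X = (s I - A)\<^sup>-\<^sup>1 B\<close>.\<close>

definition solves :: "complex mat \<Rightarrow> complex mat \<Rightarrow> tf \<Rightarrow> bool" where
  "solves A B X \<longleftrightarrow> dim_col A = dim_row A \<and> dim_row B = dim_row A \<and>
     dim_row X = dim_row A \<and> dim_col X = dim_col B \<and>
     rat_s \<cdot>\<^sub>m X = tf_const B + tf_const A * X"

text \<open>The determinant of \<open>s I - A\<close> is the image of the characteristic polynomial
  in the fraction field, and that polynomial is monic.\<close>

lemma resolvent_exists:
  assumes "A \<in> carrier_mat n n"
  obtains R where "R \<in> carrier_mat n n"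
    "(rat_s \<cdot>\<^sub>m 1\<^sub>m n - tf_const A) * R = 1\<^sub>m n" "R * (rat_s \<cdot>\<^sub>m 1\<^sub>m n - tf_const A) = 1\<^sub>m n"
proof -
  interpret inj_comm_ring_hom "to_fract :: complex poly \<Rightarrow> _" by (unfold_locales, auto)
  have "rat_s \<cdot>\<^sub>m 1\<^sub>m n - tf_const A = map_mat to_fract (char_poly_matrix A)"
    using assms
    by (intro eq_matI)
      (auto simp: char_poly_matrix_def rat_s_def rat_const_def to_fract_def Zero_fract_def eq_fract
        one_pCons)
  moreover have "det (char_poly_matrix A) \<noteq> 0"
    using degree_monic_char_poly[OF assms] unfolding char_poly_def by auto
  ultimately have "det (rat_s \<cdot>\<^sub>m 1\<^sub>m n - tf_const A) \<noteq> 0"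
    by (simp add: hom_det)
  moreover have "rat_s \<cdot>\<^sub>m 1\<^sub>m n - tf_const A \<in> carrier_mat n n" using assms by (intro minus_carrier_mat) simp
  ultimately show thesis using inverse_mat_obtain that by metis
qed

lemma solves_iff:
  assumes "A \<in> carrier_mat n n" "dim_row B = n" "dim_row X = n" "dim_col X = dim_col B"
  shows "solves A B X \<longleftrightarrow> (rat_s \<cdot>\<^sub>m 1\<^sub>m n - tf_const A) * X = tf_const B"
proof -
  have "(rat_s \<cdot>\<^sub>m 1\<^sub>m n - tf_const A) * X = rat_s \<cdot>\<^sub>m 1\<^sub>m n * X - tf_const A * X"
    by (rule minus_mult_distrib_mat[of _ n n _ _ "dim_col X"])
      (use assms in \<open>auto intro: carrier_matI\<close>)
  also have "rat_s \<cdot>\<^sub>m 1\<^sub>m n * X = rat_s \<cdot>\<^sub>m X"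
    using assms left_mult_one_mat[of X n "dim_col X"] by (subst smult_mult_mat) (auto intro: carrier_matI)
  finally have *: "(rat_s \<cdot>\<^sub>m 1\<^sub>m n - tf_const A) * X = rat_s \<cdot>\<^sub>m X - tf_const A * X" .
  have "rat_s \<cdot>\<^sub>m X - tf_const A * X = tf_const B \<longleftrightarrow> rat_s \<cdot>\<^sub>m X = tf_const B + tf_const A * X"
    (is "?l \<longleftrightarrow> ?r")
  proof
    assume eq: ?l
    show ?r
    proof (rule eq_matI)
      fix i j assume "i < dim_row (tf_const B + tf_const A * X)" "j < dim_col (tf_const B + tf_const A * X)"
      thus "(rat_s \<cdot>\<^sub>m X) $$ (i,j) = (tf_const B + tf_const A * X) $$ (i,j)"
        using arg_cong[OF eq, of "\<lambda>M. M $$ (i,j)"] assms by (auto simp: algebra_simps)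
    qed (use assms in auto)
  next
    assume eq: ?r
    show ?l
    proof (rule eq_matI)
      fix i j assume "i < dim_row (tf_const B)" "j < dim_col (tf_const B)"
      thus "(rat_s \<cdot>\<^sub>m X - tf_const A * X) $$ (i,j) = tf_const B $$ (i,j)"
        using arg_cong[OF eq, of "\<lambda>M. M $$ (i,j)"] assms by (auto simp: algebra_simps)
    qed (use assms in auto)
  qed
  thus ?thesis using * assms by (auto simp: solves_def)
qed

text \<open>Trading the resolvent for a solution \<open>X\<close> of a linear equation means that an
  interconnection is verified by exhibiting its state; no block matrix over the rational functions
  has to be inverted.\<close>

lemma realization_iff:
  assumes "dim_row A = n" "dim_row G = p" "dim_col G = m"
  shows "realization G A B C D \<longleftrightarrow> (\<exists>X. solves A B X \<and> dim_col B = m \<and>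
     C \<in> carrier_mat p n \<and> D \<in> carrier_mat p m \<and> G = tf_const D + tf_const C * X)" (is "?l \<longleftrightarrow> ?r")
proof -
  define S where "S = rat_s \<cdot>\<^sub>m 1\<^sub>m n - tf_const A"
  have dim_S: "dim_row S = dim_row A" using assms by (simp add: S_def)
  have *: "?l \<longleftrightarrow> A \<in> carrier_mat n n \<and> B \<in> carrier_mat n m \<and> C \<in> carrier_mat p n \<and>
    D \<in> carrier_mat p m \<and> (\<exists>R \<in> carrier_mat n n. S * R = 1\<^sub>m n \<and> R * S = 1\<^sub>m n \<and>
      G = tf_const D + tf_const C * R * tf_const B)"
    unfolding realization_def Let_def inverts_mat_def assms S_def[symmetric] dim_S
    by (intro conj_cong bex_cong refl) (metis carrier_matD(1))
  show ?thesis
  proof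
    assume ?l
    then obtain R where A: "A \<in> carrier_mat n n" and B: "B \<in> carrier_mat n m"
      and C: "C \<in> carrier_mat p n" and D: "D \<in> carrier_mat p m"
      and R: "R \<in> carrier_mat n n" "S * R = 1\<^sub>m n" and G: "G = tf_const D + tf_const C * R * tf_const B"
      using * by blast
    have S: "S \<in> carrier_mat n n" using A by (auto simp: S_def)
    have "S * (R * tf_const B) = tf_const B"
      using assoc_mult_mat[OF S R(1), of "tf_const B" m] R(2) B
        left_mult_one_mat[of "tf_const B" n m] by simp
    hence "solves A B (R * tf_const B)"
      using solves_iff[OF A, of B "R * tf_const B"] carrier_matD[OF R(1)] carrier_matD[OF B]
      unfolding S_def by simp
    moreover have "tf_const C * R * tf_const B = tf_const C * (R * tf_const B)"
      using assoc_mult_mat[of "tf_const C" p n R n "tf_const B" m] R C B by simp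
    ultimately show ?r using B C D G by (metis carrier_matD(2))
  next
    assume ?r
    then obtain X where X: "solves A B X" and Bm: "dim_col B = m" and C: "C \<in> carrier_mat p n"
      and D: "D \<in> carrier_mat p m" and G: "G = tf_const D + tf_const C * X" by blast
    from X Bm assms have A: "A \<in> carrier_mat n n" and B: "B \<in> carrier_mat n m" and X': "X \<in> carrier_mat n m"
      by (auto simp: solves_def)
    obtain R where R: "R \<in> carrier_mat n n" "S * R = 1\<^sub>m n" "R * S = 1\<^sub>m n"
      using resolvent_exists[OF A] unfolding S_def by metis
    have S: "S \<in> carrier_mat n n" using A by (auto simp: S_def)
    have "S * X = tf_const B"
      using X solves_iff[OF A, of B X] B X' by (auto simp: S_def)
    hence "X = R * tf_const B"
      using assoc_mult_mat[OF R(1) S X'] R(3) left_mult_one_mat[OF X'] by simp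
    moreover have "tf_const C * R * tf_const B = tf_const C * (R * tf_const B)"
      using assoc_mult_mat[of "tf_const C" p n R n "tf_const B" m] R C B by simp
    ultimately have "G = tf_const D + tf_const C * R * tf_const B" using G by metis
    thus ?l using * A B C D R by blast
  qed
qed

lemma realization_dims:
  assumes "realization G A B C D"
  shows "A \<in> carrier_mat (dim_row A) (dim_row A)" "B \<in> carrier_mat (dim_row A) (dim_col G)"
    "C \<in> carrier_mat (dim_row G) (dim_row A)" "D \<in> carrier_mat (dim_row G) (dim_col G)"
  using assms unfolding realization_def Let_def by auto

lemma realization_carrier:
  assumes "realization G A B C D" "dim_row A = n" "dim_row G = p" "dim_col G = m"
  shows "A \<in> carrier_mat n n" "B \<in> carrier_mat n m" "C \<in> carrier_mat p n" "D \<in> carrier_mat p m"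
  using realization_dims[OF assms(1)] by (simp_all only: assms(2-4))

text \<open>\<open>B\<close> and \<open>C\<close> change places, and the transposed resolvent
  inverts \<open>s I - A^T\<close>. All dual statements, on controllability and on output
  directions, come from here.\<close>

lemma realization_transpose:
  assumes "realization G A B C D"
  shows "realization (transpose_mat G) (transpose_mat A) (transpose_mat C) (transpose_mat B) (transpose_mat D)"
proof -
  define n p m where "n = dim_row A" and "p = dim_row G" and "m = dim_col G"
  define S where "S = rat_s \<cdot>\<^sub>m 1\<^sub>m n - tf_const A"
  obtain R where R: "A \<in> carrier_mat n n" "B \<in> carrier_mat n m"
    "C \<in> carrier_mat p n" "D \<in> carrier_mat p m"
    "R \<in> carrier_mat n n" "S * R = 1\<^sub>m n" "R * S = 1\<^sub>m n"
    "G = tf_const D + tf_const C * R * tf_const B"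
    using assms unfolding realization_def Let_def inverts_mat_def n_def S_def p_def m_def
    by (metis index_minus_mat(2) tf_const_dim(1) carrier_matD(1))
  have S: "S \<in> carrier_mat n n" using R(1) by (auto simp: S_def)
  have ST: "rat_s \<cdot>\<^sub>m 1\<^sub>m n - tf_const (transpose_mat A) = transpose_mat S"
    using R(1) by (auto simp: S_def tf_const_transpose)
  have "transpose_mat G = tf_const (transpose_mat D) + transpose_mat (tf_const C * R * tf_const B)"
    using R(2-5) by (subst R(8), subst transpose_add[of _ p m]) (auto simp: tf_const_transpose)
  also have "transpose_mat (tf_const C * R * tf_const B)
      = tf_const (transpose_mat B) * (transpose_mat R * tf_const (transpose_mat C))"
    using R(2,3,5) transpose_mult[of "tf_const C * R" p n "tf_const B" m]
      transpose_mult[of "tf_const C" p n R n] by (simp add: tf_const_transpose)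
  also have "\<dots> = tf_const (transpose_mat B) * transpose_mat R * tf_const (transpose_mat C)"
    using R(2,3,5) by (subst mult_assoc_mat) auto
  finally have G: "transpose_mat G = tf_const (transpose_mat D) +
      tf_const (transpose_mat B) * transpose_mat R * tf_const (transpose_mat C)" .
  have "transpose_mat S * transpose_mat R = 1\<^sub>m n" "transpose_mat R * transpose_mat S = 1\<^sub>m n"
    using R(5-7) S by (metis transpose_mult transpose_one)+
  moreover have "dim_row (transpose_mat A) = n" "dim_row (transpose_mat G) = m" "dim_col (transpose_mat G) = p"
    using R(1) by (auto simp: p_def m_def)
  ultimately show ?thesis unfolding realization_def Let_def inverts_mat_def
    using R(1-5) S G by (auto simp: ST intro!: bexI[of _ "transpose_mat R"])
qed

text \<open>If the entries of \<open>X\<close> grow at most like \<open>s^d\<close> with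
  \<open>d \<ge> 0\<close>, so does \<open>A X + B = s X\<close>, and division by s improves the
  bound to \<open>d - 1\<close>. The descent starts from any common bound and ends at -1, where the
  constant \<open>B\<close> stops it.\<close>

lemma solves_strictly_proper:
  assumes "solves A B X"
  shows "strictly_proper_mat X"
proof -
  define I where "I = {..<dim_row X} \<times> {..<dim_col X}"
  have step: "\<forall>(i,j)\<in>I. deg_le (X $$ (i,j)) (int d - 1)" if "\<forall>(i,j)\<in>I. deg_le (X $$ (i,j)) (int d)" for d :: nat
  proof clarify
    fix i j assume ij: "(i,j) \<in> I"
    have "rat_s * X $$ (i,j) = (tf_const B + tf_const A * X) $$ (i,j)"
      using assms ij by (auto simp: solves_def I_def dest!: arg_cong[of _ _ "\<lambda>M. M $$ (i,j)"])
    also have "\<dots> = rat_const (B $$ (i,j)) + (\<Sum>k<dim_row X. rat_const (A $$ (i,k)) * X $$ (k,j))"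
      using assms ij by (auto simp: solves_def I_def scalar_prod_def atLeast0LessThan)
    finally have "deg_le (rat_s * X $$ (i,j)) (int d)"
      using that ij by (auto simp: I_def intro!: deg_le_add deg_le_rat_const deg_le_sum deg_le_const_mult)
    thus "deg_le (X $$ (i,j)) (int d - 1)" by (rule deg_le_div_s)
  qed
  obtain f :: "nat \<times> nat \<Rightarrow> nat" where f: "\<And>x. deg_le (X $$ x) (int (f x))"
    using choice[of "\<lambda>x d. deg_le (X $$ x) (int d)"] deg_le_bound by blast
  have fin: "finite I" by (simp add: I_def)
  \<comment> \<open>Inserting 0 keeps \<open>Max\<close> meaningful when \<open>X\<close> has no
    entries.\<close>
  have "\<forall>(i,j)\<in>I. deg_le (X $$ (i,j)) (int (Max (insert 0 (f ` I))))"
    using f fin by (auto intro!: deg_le_mono[OF f])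
  moreover have "\<forall>(i,j)\<in>I. deg_le (X $$ (i,j)) (- 1)" if "\<forall>(i,j)\<in>I. deg_le (X $$ (i,j)) (int d)" for d
    using that
  proof (induction d)
    case 0 thus ?case using step[of 0] by simp
  next
    case (Suc d) thus ?case using step[of "Suc d"] by simp
  qed
  ultimately show ?thesis by (auto simp: strictly_proper_mat_def I_def)
qed

subsection \<open>Observability\<close>

lemma append_rows_dim [simp]:
  "dim_row (U @\<^sub>r V) = dim_row U + dim_row V" "dim_col (U @\<^sub>r V) = dim_col U"
  by (simp_all add: append_rows_def)

lemma append_rows_index:
  "i < dim_row U + dim_row V \<Longrightarrow> j < dim_col U \<Longrightarrow>
    (U @\<^sub>r V) $$ (i,j) = (if i < dim_row U then U $$ (i,j) else V $$ (i - dim_row U, j))"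
  by (simp add: append_rows_def)

lemma row_append_rows:
  "i < dim_row U + dim_row V \<Longrightarrow> dim_col V = dim_col U \<Longrightarrow>
    row (U @\<^sub>r V) i = (if i < dim_row U then row U i else row V (i - dim_row U))"
  by (intro eq_vecI) (auto simp: append_rows_index)

lemma append_rows_mult:
  assumes "dim_col U = dim_row W" "dim_col V = dim_row W"
  shows "(U @\<^sub>r V) * W = (U * W) @\<^sub>r (V * W)"
proof (rule eq_matI)
  fix i j assume ij: "i < dim_row ((U * W) @\<^sub>r (V * W))" "j < dim_col ((U * W) @\<^sub>r (V * W))"
  thus "((U @\<^sub>r V) * W) $$ (i,j) = ((U * W) @\<^sub>r (V * W)) $$ (i,j)"
    using assms by (auto simp: append_rows_index row_append_rows)
qed (use assms in auto)

lemma append_rows_mult_vec_0: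
  fixes U V :: "'a :: semiring_0 mat"
  assumes "dim_col V = dim_col U" and 0: "(U @\<^sub>r V) *\<^sub>v v = 0\<^sub>v k"
  shows "U *\<^sub>v v = 0\<^sub>v (dim_row U)" "V *\<^sub>v v = 0\<^sub>v (dim_row V)"
proof -
  have "k = dim_row U + dim_row V"
    using arg_cong[OF 0, of dim_vec] by simp
  hence *: "row (U @\<^sub>r V) i \<bullet> v = 0" if "i < dim_row U + dim_row V" for i
    using that arg_cong[OF 0, of "\<lambda>u. u $ i"] by simp
  show "U *\<^sub>v v = 0\<^sub>v (dim_row U)"
  proof (rule eq_vecI)
    fix i assume "i < dim_vec (0\<^sub>v (dim_row U) :: 'a vec)"
    thus "(U *\<^sub>v v) $ i = 0\<^sub>v (dim_row U) $ i"
      using *[of i] assms(1) by (simp add: row_append_rows)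
  qed simp
  show "V *\<^sub>v v = 0\<^sub>v (dim_row V)"
  proof (rule eq_vecI)
    fix i assume "i < dim_vec (0\<^sub>v (dim_row V) :: 'a vec)"
    thus "(V *\<^sub>v v) $ i = 0\<^sub>v (dim_row V) $ i"
      using *[of "i + dim_row U"] assms(1) by (simp add: row_append_rows)
  qed simp
qed

text \<open>Kalman's observability matrix with the blocks \<open>C A^j\<close> for
  \<open>j < N\<close>. The recursion absorbs \<open>A\<close> into \<open>C\<close>, so no matrix
  powers occur and inductions generalize over \<open>C\<close>.\<close>

fun obs_mat :: "complex mat \<Rightarrow> complex mat \<Rightarrow> nat \<Rightarrow> complex mat" where
  "obs_mat A C 0 = 0\<^sub>m 0 (dim_row A)"
| "obs_mat A C (Suc N) = C @\<^sub>r obs_mat A (C * A) N"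

lemma obs_mat_dim [simp]:
  "dim_row (obs_mat A C N) = N * dim_row C"
  "dim_col A = dim_row A \<Longrightarrow> dim_col C = dim_row A \<Longrightarrow> dim_col (obs_mat A C N) = dim_row A"
  by (induction N arbitrary: C) auto

text \<open>The Popov--Belevitch--Hautus form of observability and controllability.\<close>

definition observable :: "complex mat \<Rightarrow> complex mat \<Rightarrow> bool" where
  "observable A C \<longleftrightarrow> (\<forall>v z. v \<in> carrier_vec (dim_row A) \<longrightarrow> A *\<^sub>v v = z \<cdot>\<^sub>v v \<longrightarrow>
     C *\<^sub>v v = 0\<^sub>v (dim_row C) \<longrightarrow> v = 0\<^sub>v (dim_row A))"

definition controllable :: "complex mat \<Rightarrow> complex mat \<Rightarrow> bool" where
  "controllable A B \<longleftrightarrow> observable (transpose_mat A) (transpose_mat B)"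

lemma obs_mat_kernel:
  assumes "A \<in> carrier_mat n n" "dim_col C = n" "x \<in> carrier_vec n"
    and "obs_mat A C N *\<^sub>v x = 0\<^sub>v (N * dim_row C)" "j < N"
  shows "C *\<^sub>v (((*\<^sub>v) A ^^ j) x) = 0\<^sub>v (dim_row C)"
  using assms
proof (induction N arbitrary: C j)
  case (Suc N)
  have *: "C *\<^sub>v x = 0\<^sub>v (dim_row C)" "obs_mat A (C * A) N *\<^sub>v x = 0\<^sub>v (N * dim_row C)"
    using append_rows_mult_vec_0[of "obs_mat A (C * A) N" C] Suc.prems by auto
  have pow: "((*\<^sub>v) A ^^ i) x \<in> carrier_vec n" for i
    using Suc.prems by (induction i) auto
  show ?case
  proof (cases j)
    case (Suc i)
    hence "C * A *\<^sub>v (((*\<^sub>v) A ^^ i) x) = 0\<^sub>v (dim_row C)"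
      using Suc.IH[of "C * A" i] Suc.prems * by auto
    thus ?thesis using Suc Suc.prems pow[of i]
      by (simp add: mult_assoc_mat_vec)
  qed (use * in auto)
qed simp

text \<open>In a triangular basis, applying \<open>T - t\<^sub>k\<^sub>k\<close> shortens the support of \<open>y\<close>; the last nonzero
  vector obtained in this way is an eigenvector.\<close>

lemma upper_triangular_invariant_eigenvector:
  fixes T C :: "complex mat"
  assumes T: "T \<in> carrier_mat n n" "upper_triangular T" and C: "C \<in> carrier_mat c n"
    and "k \<le> n" and y: "y \<in> carrier_vec n" "y \<noteq> 0\<^sub>v n"
    and "\<And>i. k \<le> i \<Longrightarrow> i < n \<Longrightarrow> y $ i = 0"
    and "\<And>j. j < k \<Longrightarrow> C *\<^sub>v (((*\<^sub>v) T ^^ j) y) = 0\<^sub>v c"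
  shows "\<exists>z w. w \<in> carrier_vec n \<and> w \<noteq> 0\<^sub>v n \<and> T *\<^sub>v w = z \<cdot>\<^sub>v w \<and> C *\<^sub>v w = 0\<^sub>v c"
  using assms(4-)
proof (induction k arbitrary: y)
  case 0
  hence "y = 0\<^sub>v n" by (intro eq_vecI) auto
  with 0 show ?case by simp
next
  case (Suc k)
  define z where "z = T $$ (k,k)"
  define y' where "y' = T *\<^sub>v y - z \<cdot>\<^sub>v y"
  have y: "y \<in> carrier_vec n" and Ty: "T *\<^sub>v y \<in> carrier_vec n" using Suc.prems T by auto
  show ?case
  proof (cases "y' = 0\<^sub>v n")
    case True
    have "T *\<^sub>v y = z \<cdot>\<^sub>v y"
    proof (rule eq_vecI)
      fix i assume "i < dim_vec (z \<cdot>\<^sub>v y)"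
      thus "(T *\<^sub>v y) $ i = (z \<cdot>\<^sub>v y) $ i"
        using arg_cong[OF True, of "\<lambda>u. u $ i"] y T(1) by (simp add: y'_def del: index_mult_mat_vec)
    qed (use y T in auto)
    thus ?thesis using Suc.prems(2,3) Suc.prems(5)[of 0] by auto
  next
    case False
    have y': "y' \<in> carrier_vec n" using y Ty by (simp add: y'_def)
    have pow: "((*\<^sub>v) T ^^ j) u \<in> carrier_vec n" if "u \<in> carrier_vec n" for u j
      using that T by (induction j) auto
    \<comment> \<open>\<open>T - z\<close> commutes with the powers of \<open>T\<close>, so
      \<open>y'\<close> is annihilated by the same products \<open>C T^j\<close>, with one exponent
      fewer at its disposal.\<close>
    have lin: "((*\<^sub>v) T ^^ j) y' = ((*\<^sub>v) T ^^ Suc j) y - z \<cdot>\<^sub>v ((*\<^sub>v) T ^^ j) y" for j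
    proof (induction j)
      case (Suc j)
      have "((*\<^sub>v) T ^^ Suc j) y' = T *\<^sub>v (((*\<^sub>v) T ^^ Suc j) y - z \<cdot>\<^sub>v ((*\<^sub>v) T ^^ j) y)"
        using Suc by simp
      also have "\<dots> = T *\<^sub>v (((*\<^sub>v) T ^^ Suc j) y) - z \<cdot>\<^sub>v (T *\<^sub>v (((*\<^sub>v) T ^^ j) y))"
        using pow[OF y, of j] pow[OF y, of "Suc j"] T
        by (metis mult_mat_vec mult_minus_distrib_mat_vec smult_carrier_vec)
      finally show ?case by simp
    qed (simp add: y'_def)
    show ?thesis
    proof (rule Suc.IH)
      fix i assume i: "k \<le> i" "i < n"
      have "(T *\<^sub>v y) $ i = (\<Sum>l<n. T $$ (i,l) * y $ l)"
        using i T y by (simp add: scalar_prod_def atLeast0LessThan)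
      \<comment> \<open>For \<open>i = k\<close> only the diagonal term survives; for
        \<open>i > k\<close> all terms vanish, and so does the right side because
        \<open>y $ i = 0\<close>. One formula covers both cases.\<close>
      also have "\<dots> = (\<Sum>l<n. if l = k then z * y $ i else 0)"
      proof (rule sum.cong[OF refl])
        fix l assume l: "l \<in> {..<n}"
        show "T $$ (i,l) * y $ l = (if l = k then z * y $ i else 0)"
        proof (cases "l < i")
          case True
          hence "T $$ (i,l) = 0" using T i l by (auto simp: upper_triangular_def)
          thus ?thesis using True i Suc.prems(4)[of i] by auto
        next
          case False
          thus ?thesis using Suc.prems(4)[of l] i l by (cases "l = k") (auto simp: z_def)
        qed
      qed
      also have "\<dots> = z * y $ i" using Suc.prems by simp
      finally show "y' $ i = 0" using i y T by (simp add: y'_def del: index_mult_mat_vec)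
    next
      fix j assume j: "j < k"
      have "C *\<^sub>v (((*\<^sub>v) T ^^ j) y') = C *\<^sub>v (((*\<^sub>v) T ^^ Suc j) y) - z \<cdot>\<^sub>v (C *\<^sub>v (((*\<^sub>v) T ^^ j) y))"
        unfolding lin using pow[OF y, of j] pow[OF y, of "Suc j"] C
        by (metis mult_mat_vec mult_minus_distrib_mat_vec smult_carrier_vec)
      thus "C *\<^sub>v (((*\<^sub>v) T ^^ j) y') = 0\<^sub>v c"
        using Suc.prems(5)[of "Suc j"] Suc.prems(5)[of j] j by (auto intro!: eq_vecI)
    qed (use Suc.prems False y' in auto)
  qed
qed

text \<open>A Schur decomposition \<open>A = S T Q\<close> carries a kernel vector \<open>x\<close>
  to \<open>Q x\<close>, which is unobservable for the pair \<open>T\<close>, \<open>C S\<close>.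
  The triangular argument yields an eigenvector \<open>w\<close> there, and \<open>S w\<close>
  contradicts the eigenvector test. The \<open>n\<close> blocks match the \<open>n\<close> possible
  support lengths of \<open>Q x\<close>, so no appeal to Cayley-Hamilton is made.\<close>

lemma obs_mat_inj:
  assumes A: "A \<in> carrier_mat n n" and C: "C \<in> carrier_mat c n" and "observable A C"
    and x: "x \<in> carrier_vec n" and ker: "obs_mat A C n *\<^sub>v x = 0\<^sub>v (n * c)"
  shows "x = 0\<^sub>v n"
proof (rule ccontr)
  assume "x \<noteq> 0\<^sub>v n"
  obtain es where "char_poly A = (\<Prod>a\<leftarrow>es. [:- a, 1:])" using char_poly_factorized[OF A] by blast
  from schur_decomposition_exists[OF A this] obtain T where T: "T \<in> carrier_mat n n"
    "upper_triangular T" "similar_mat A T" by blast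
  then obtain S Q where "similar_mat_wit A T S Q" by (auto simp: similar_mat_def)
  from similar_mat_witD2[OF A this] have SQ: "S * Q = 1\<^sub>m n" "Q * S = 1\<^sub>m n" "A = S * T * Q"
    "S \<in> carrier_mat n n" "Q \<in> carrier_mat n n" by auto
  have pow: "((*\<^sub>v) T ^^ j) (Q *\<^sub>v x) \<in> carrier_vec n" for j
    using T SQ x by (induction j) auto
  have iter: "((*\<^sub>v) A ^^ j) x = S *\<^sub>v (((*\<^sub>v) T ^^ j) (Q *\<^sub>v x))" for j
  proof (induction j)
    case 0
    have "x = S * Q *\<^sub>v x" using SQ x by simp
    also have "\<dots> = S *\<^sub>v (Q *\<^sub>v x)" using SQ x by (intro mult_assoc_mat_vec) auto
    finally show ?case by simp
  next
    case (Suc j)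
    define u where "u = ((*\<^sub>v) T ^^ j) (Q *\<^sub>v x)"
    have u: "u \<in> carrier_vec n" using pow by (simp add: u_def)
    have "A * S = S * T * (Q * S)"
      using SQ T by (simp add: mult_assoc_mat)
    hence "A * S = S * T" using SQ T by simp
    hence "A *\<^sub>v (S *\<^sub>v u) = S *\<^sub>v (T *\<^sub>v u)"
      using A SQ T u by (metis assoc_mult_mat_vec)
    thus ?case using Suc by (simp add: u_def)
  qed
  have "Q *\<^sub>v x \<noteq> 0\<^sub>v n"
  proof
    assume "Q *\<^sub>v x = 0\<^sub>v n"
    with iter[of 0] SQ have "x = 0\<^sub>v n" by (auto intro!: eq_vecI)
    with \<open>x \<noteq> 0\<^sub>v n\<close> show False by simp
  qed
  moreover have "C * S *\<^sub>v (((*\<^sub>v) T ^^ j) (Q *\<^sub>v x)) = 0\<^sub>v c" if "j < n" for j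
    using obs_mat_kernel[OF A _ x, of C n j] ker that C SQ(4) pow[of j]
    unfolding iter by (simp add: mult_assoc_mat_vec)
  ultimately obtain z w where w: "w \<in> carrier_vec n" "w \<noteq> 0\<^sub>v n" "T *\<^sub>v w = z \<cdot>\<^sub>v w"
    "C * S *\<^sub>v w = 0\<^sub>v c"
    using upper_triangular_invariant_eigenvector[OF T(1,2), of "C * S" c n "Q *\<^sub>v x"] SQ C x by auto
  have "A * S = S * T * (Q * S)"
    using SQ T by (simp add: mult_assoc_mat)
  hence "A * S = S * T" using SQ T by simp
  hence "A *\<^sub>v (S *\<^sub>v w) = S *\<^sub>v (z \<cdot>\<^sub>v w)"
    using A SQ T w by (metis assoc_mult_mat_vec)
  hence "A *\<^sub>v (S *\<^sub>v w) = z \<cdot>\<^sub>v (S *\<^sub>v w)" using SQ w by (simp add: mult_mat_vec)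
  moreover have "C *\<^sub>v (S *\<^sub>v w) = 0\<^sub>v c" using w C SQ by (simp add: mult_assoc_mat_vec)
  ultimately have "S *\<^sub>v w = 0\<^sub>v n"
    using \<open>observable A C\<close> carrier_matD(1)[OF A] carrier_matD(1)[OF C]
      mult_mat_vec_carrier[OF SQ(4) w(1)] unfolding observable_def by metis
  hence "Q * S *\<^sub>v w = Q *\<^sub>v 0\<^sub>v n" using SQ(4,5) w by (simp add: mult_assoc_mat_vec)
  also have "Q *\<^sub>v 0\<^sub>v n = 0\<^sub>v n" using SQ by (auto intro!: eq_vecI)
  finally have "w = 0\<^sub>v n" using SQ w by simp
  with w show False by simp
qed

lemma obs_mat_left_inverse:
  assumes A: "A \<in> carrier_mat n n" and C: "C \<in> carrier_mat c n" and "observable A C"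
  obtains L where "L \<in> carrier_mat n (n * c)" "L * obs_mat A C n = 1\<^sub>m n"
proof -
  have "obs_mat A C n \<in> carrier_mat (n * c) n" using A C by (intro carrier_matI) auto
  from complex_mat_left_inverse[OF this] obs_mat_inj[OF assms] that show thesis by metis
qed

lemma realizationE:
  assumes "realization G A B C D"
  obtains n p m X where "solves A B X" "A \<in> carrier_mat n n" "B \<in> carrier_mat n m" "C \<in> carrier_mat p n"
    "D \<in> carrier_mat p m" "X \<in> carrier_mat n m" "G = tf_const D + tf_const C * X" "dim_row G = p" "dim_col G = m"
proof -
  obtain X where X: "solves A B X" "dim_col B = dim_col G" "C \<in> carrier_mat (dim_row G) (dim_row A)"
    "D \<in> carrier_mat (dim_row G) (dim_col G)" "G = tf_const D + tf_const C * X"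
    using assms realization_iff[OF refl refl refl, of G A B C D] by blast
  moreover have "dim_row X = dim_row A" "dim_col X = dim_col G"
    using X(1,2) by (auto simp only: solves_def)
  ultimately show thesis
    using that[OF X(1) _ _ X(3,4) _ X(5) refl refl] realization_dims[OF assms] by blast
qed

lemma realizationI:
  assumes "solves A B X" "C \<in> carrier_mat p (dim_row A)" "D \<in> carrier_mat p (dim_col B)"
  shows "realization (tf_const D + tf_const C * X) A B C D"
  using assms realization_iff[OF refl refl refl, of "tf_const D + tf_const C * X" A B C D]
  by (auto simp: solves_def)

subsection \<open>Comparing realizations of the same transfer function\<close>

locale solution_pair =
  fixes A B A0 B0 :: "complex mat" and X X0 :: tf and n n0 m :: nat
  assumes sol: "solves A B X" "solves A0 B0 X0"
    and dim: "A \<in> carrier_mat n n" "A0 \<in> carrier_mat n0 n0" "dim_col B = m" "dim_col B0 = m"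
begin

text \<open>The states \<open>X\<close>, \<open>X0\<close> are fixed while the output matrices vary:
  the relation is preserved by stacking and by multiplication with \<open>A\<close> and
  \<open>A0\<close>, and so passes to observability matrices.\<close>

definition equal_outputs :: "complex mat \<Rightarrow> complex mat \<Rightarrow> bool" where
  "equal_outputs C C0 \<longleftrightarrow> dim_col C = n \<and> dim_col C0 = n0 \<and> dim_row C0 = dim_row C \<and>
     tf_const C * X = tf_const C0 * X0"

lemma dims:
  "dim_row A = n" "dim_col A = n" "dim_row A0 = n0" "dim_col A0 = n0" "dim_row B = n" "dim_row B0 = n0"
  "dim_col B = m" "dim_col B0 = m" "dim_row X = n" "dim_row X0 = n0" "dim_col X = m" "dim_col X0 = m"
  using sol dim by (auto simp: solves_def)

lemma state_eq:
  "rat_s \<cdot>\<^sub>m X = tf_const B + tf_const A * X" "rat_s \<cdot>\<^sub>m X0 = tf_const B0 + tf_const A0 * X0"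
  using sol by (simp_all add: solves_def)

text \<open>Multiplying by s and inserting the state equations gives
  \<open>C B + C A X = C0 B0 + C0 A0 X0\<close>. Constant and strictly proper parts agree
  separately, which yields one Markov parameter and a new pair with equal outputs.\<close>

lemma equal_outputs_step:
  assumes "equal_outputs C C0"
  shows "C * B = C0 * B0" "equal_outputs (C * A) (C0 * A0)"
proof -
  have dC: "dim_col C = n" "dim_col C0 = n0" "dim_row C0 = dim_row C"
    and eq: "tf_const C * X = tf_const C0 * X0" using assms by (auto simp: equal_outputs_def)
  have "tf_const (C * B) + tf_const (C * A) * X = rat_s \<cdot>\<^sub>m (tf_const C * X)"
    using dC dims by (simp add: mult_smult_mat[symmetric] state_eq mult_add_mat tf_const_mult mult_assoc_mat)
  also have "\<dots> = rat_s \<cdot>\<^sub>m (tf_const C0 * X0)"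
    using eq by simp
  also have "\<dots> = tf_const (C0 * B0) + tf_const (C0 * A0) * X0"
    using dC dims by (simp add: mult_smult_mat[symmetric] state_eq mult_add_mat tf_const_mult mult_assoc_mat)
  finally have eq: "tf_const (C * B) + tf_const (C * A) * X = tf_const (C0 * B0) + tf_const (C0 * A0) * X0" .
  have sp: "strictly_proper_mat (tf_const (C * A) * X)" "strictly_proper_mat (tf_const (C0 * A0) * X0)"
    using sol[THEN solves_strictly_proper] dims
    by (auto intro!: strictly_proper_const_mult)
  from const_plus_strictly_proper_unique[OF eq sp] dC dims
  show "C * B = C0 * B0" "equal_outputs (C * A) (C0 * A0)" by (auto simp: equal_outputs_def)
qed

lemma equal_outputs_append:
  assumes "equal_outputs C C0" "equal_outputs V V0"
  shows "equal_outputs (C @\<^sub>r V) (C0 @\<^sub>r V0)"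
proof -
  have tf: "tf_const (U @\<^sub>r U') = tf_const U @\<^sub>r tf_const U'" if "dim_col U' = dim_col U" for U U'
    using that by (intro eq_matI) (auto simp: append_rows_index)
  show ?thesis using assms dims by (auto simp: equal_outputs_def tf append_rows_mult)
qed

lemma equal_outputs_obs_mat:
  "equal_outputs C C0 \<Longrightarrow> equal_outputs (obs_mat A C N) (obs_mat A0 C0 N)"
proof (induction N arbitrary: C C0)
  case 0
  show ?case using dims by (auto simp: equal_outputs_def intro!: eq_matI)
next
  case (Suc N)
  thus ?case using equal_outputs_step(2) equal_outputs_append by simp
qed

text \<open>The dual observability matrix is the transposed controllability matrix, so this says that the
  Hankel matrices of the two systems agree.\<close>

lemma equal_outputs_ctrl_mat:
  assumes "equal_outputs C C0"
  shows "obs_mat (transpose_mat A) (transpose_mat B) N * transpose_mat C =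
    obs_mat (transpose_mat A0) (transpose_mat B0) N * transpose_mat C0"
proof -
  \<comment> \<open>The recursion replaces \<open>H\<close> by \<open>H * transpose_mat A\<close>.
    The assumption on \<open>H\<close> must therefore cover all pairs with equal outputs, so that
    the new factor can be moved into the pair by \<open>equal_outputs_step\<close>.\<close>
  have "obs_mat (transpose_mat A) H N * transpose_mat C =
      obs_mat (transpose_mat A0) H0 N * transpose_mat C0"
    if "equal_outputs C C0" "dim_col H = n" "dim_col H0 = n0" "dim_row H0 = dim_row H"
      and H: "\<And>C C0. equal_outputs C C0 \<Longrightarrow> H * transpose_mat C = H0 * transpose_mat C0" for C C0 H H0
    using that
  proof (induction N arbitrary: H H0)
    case 0
    thus ?case using dims by (intro eq_matI) (auto simp: equal_outputs_def)
  next
    case (Suc N)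
    have *: "H * transpose_mat A * transpose_mat V = H0 * transpose_mat A0 * transpose_mat V0"
      if "equal_outputs V V0" for V V0
    proof -
      have "transpose_mat (V * A) = transpose_mat A * transpose_mat V"
        "transpose_mat (V0 * A0) = transpose_mat A0 * transpose_mat V0"
        using that dims by (auto simp: transpose_mult_mat equal_outputs_def)
      thus ?thesis
        using Suc.prems(5)[OF equal_outputs_step(2)[OF that]] that Suc.prems(2-4) dims
        by (simp add: mult_assoc_mat equal_outputs_def)
    qed
    have "obs_mat (transpose_mat A) (H * transpose_mat A) N * transpose_mat C =
        obs_mat (transpose_mat A0) (H0 * transpose_mat A0) N * transpose_mat C0"
      using Suc.prems * dims by (intro Suc.IH) auto
    thus ?case
      using Suc.prems(1-4) Suc.prems(5)[OF Suc.prems(1)] dims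
      by (simp add: append_rows_mult equal_outputs_def)
  qed
  moreover have "transpose_mat B * transpose_mat C = transpose_mat B0 * transpose_mat C0"
    if eo: "equal_outputs C C0" for C C0
  proof -
    have "transpose_mat (C * B) = transpose_mat B * transpose_mat C"
      "transpose_mat (C0 * B0) = transpose_mat B0 * transpose_mat C0"
      using eo dims by (auto simp: transpose_mult_mat equal_outputs_def)
    thus ?thesis using equal_outputs_step(1)[OF eo] by simp
  qed
  ultimately show ?thesis using assms dims by simp
qed

text \<open>The Hankel identities are \<open>M Q^T = M0 Q0^T\<close> and
  \<open>M A Q^T = M0 A0 Q0^T\<close>. With a left inverse \<open>L\<close> of \<open>M\<close> and
  the right inverse \<open>K^T\<close> of \<open>Q^T\<close>, the choice \<open>S = L M0\<close> and
  \<open>T = Q0^T K^T\<close> turns them into \<open>S T = 1\<close> and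
  \<open>S A0 T = A\<close>.\<close>

lemma equal_outputs_similarity:
  assumes eo: "equal_outputs C C0" and obs: "observable A C" and ctr: "controllable A B"
  obtains S T where "S \<in> carrier_mat n n0" "T \<in> carrier_mat n0 n" "S * T = 1\<^sub>m n" "A = S * A0 * T"
proof -
  define c where "c = dim_row C"
  define M M0 where "M = obs_mat A C n" and "M0 = obs_mat A0 C0 n"
  define Q Q0 where "Q = obs_mat (transpose_mat A) (transpose_mat B) n"
    and "Q0 = obs_mat (transpose_mat A0) (transpose_mat B0) n"
  have C: "C \<in> carrier_mat c n" "C0 \<in> carrier_mat c n0"
    using eo by (auto simp: equal_outputs_def c_def)
  have M: "M \<in> carrier_mat (n * c) n" "M0 \<in> carrier_mat (n * c) n0"
    using C dims by (auto simp: M_def M0_def intro!: carrier_matI)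
  have Q: "Q \<in> carrier_mat (n * m) n" "Q0 \<in> carrier_mat (n * m) n0"
    using dims by (auto simp: Q_def Q0_def intro!: carrier_matI)
  obtain L where L: "L \<in> carrier_mat n (n * c)" "L * M = 1\<^sub>m n"
    using obs_mat_left_inverse[OF dim(1) C(1) obs] unfolding M_def by metis
  have "transpose_mat A \<in> carrier_mat n n" "transpose_mat B \<in> carrier_mat m n"
    using dims by auto
  then obtain K where K: "K \<in> carrier_mat n (n * m)" "K * Q = 1\<^sub>m n"
    using obs_mat_left_inverse ctr unfolding Q_def controllable_def by metis
  have eoM: "equal_outputs M M0"
    unfolding M_def M0_def by (rule equal_outputs_obs_mat[OF eo])
  have tr: "V * transpose_mat Q = V0 * transpose_mat Q0" if "equal_outputs V V0" for V V0
  proof -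
    have V: "dim_col V = n" "dim_col V0 = n0" using that by (auto simp: equal_outputs_def)
    have "transpose_mat (Q * transpose_mat V) = transpose_mat (Q0 * transpose_mat V0)"
      using equal_outputs_ctrl_mat[OF that, of n] by (simp add: Q_def Q0_def)
    thus ?thesis using V Q by (simp add: transpose_mult_mat)
  qed
  have QK: "transpose_mat Q * transpose_mat K = 1\<^sub>m n"
    using K Q transpose_mult_mat[of K Q] by simp
  define S T where "S = L * M0" and "T = transpose_mat Q0 * transpose_mat K"
  have d: "dim_row L = n" "dim_col L = n * c" "dim_row M = n * c" "dim_col M = n"
    "dim_row M0 = n * c" "dim_col M0 = n0" "dim_row Q = n * m" "dim_col Q = n"
    "dim_row Q0 = n * m" "dim_col Q0 = n0" "dim_row K = n" "dim_col K = n * m"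
    using L M Q K by auto
  have "S * T = L * (M0 * transpose_mat Q0 * transpose_mat K)"
    using d by (simp add: S_def T_def mult_assoc_mat)
  also have "\<dots> = L * (M * transpose_mat Q * transpose_mat K)"
    using tr[OF eoM] by simp
  also have "\<dots> = (L * M) * (transpose_mat Q * transpose_mat K)"
    using d by (simp add: mult_assoc_mat)
  finally have ST: "S * T = 1\<^sub>m n" using L QK by simp
  have "S * A0 * T = L * (M0 * A0 * transpose_mat Q0 * transpose_mat K)"
    using d dims by (simp add: S_def T_def mult_assoc_mat)
  also have "\<dots> = L * (M * A * transpose_mat Q * transpose_mat K)"
    using tr[OF equal_outputs_step(2)[OF eoM]] by simp
  also have "\<dots> = (L * M) * (A * (transpose_mat Q * transpose_mat K))"
    using d dims by (simp add: mult_assoc_mat)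
  finally have "S * A0 * T = A" using L QK dim by simp
  thus thesis using that[of S T] ST d
    by (metis S_def T_def carrier_matI index_mult_mat(2,3) index_transpose_mat(2,3))
qed

end

text \<open>\<open>S T = 1\<close> alone bounds the dimension. Once the dimensions agree, a
  one-sided inverse is two-sided and \<open>A = S A0 T\<close> becomes a similarity.\<close>

lemma realization_compare:
  assumes R: "realization G A B C D" and R0: "realization G A0 B0 C0 D0"
    and pbh: "observable A C" "controllable A B"
  shows "dim_row A \<le> dim_row A0" "dim_row A = dim_row A0 \<Longrightarrow> char_poly A = char_poly A0"
proof -
  obtain n p m X where X: "solves A B X" "A \<in> carrier_mat n n" "B \<in> carrier_mat n m"
    "C \<in> carrier_mat p n" "D \<in> carrier_mat p m" "X \<in> carrier_mat n m" "G = tf_const D + tf_const C * X"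
    and G: "dim_row G = p" "dim_col G = m"
    using R by (rule realizationE)
  obtain n0 p' m' X0 where X0: "solves A0 B0 X0" "A0 \<in> carrier_mat n0 n0" "B0 \<in> carrier_mat n0 m'"
    "C0 \<in> carrier_mat p' n0" "D0 \<in> carrier_mat p' m'" "X0 \<in> carrier_mat n0 m'"
    "G = tf_const D0 + tf_const C0 * X0" and G': "dim_row G = p'" "dim_col G = m'"
    using R0 by (rule realizationE)
  have [simp]: "p' = p" "m' = m" using G G' by auto
  interpret solution_pair A B A0 B0 X X0 n n0 m
    using X(1-3) X0(1-3) by unfold_locales auto
  have "tf_const C * X = tf_const C0 * X0"
  proof (rule const_plus_strictly_proper_unique(2))
    show "tf_const D + tf_const C * X = tf_const D0 + tf_const C0 * X0" using X(7) X0(7) by simp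
  qed (use X(4,5) X0(4,5) dims sol[THEN solves_strictly_proper] in
      \<open>auto intro!: strictly_proper_const_mult\<close>)
  hence "equal_outputs C C0"
    using X(4) X0(4) by (auto simp: equal_outputs_def)
  from equal_outputs_similarity[OF this pbh]
  obtain S T where ST: "S \<in> carrier_mat n n0" "T \<in> carrier_mat n0 n" "S * T = 1\<^sub>m n" "A = S * A0 * T" .
  show "dim_row A \<le> dim_row A0"
    using left_inverse_mat_dim_le[OF ST(1,2,3)] dims by simp
  assume "dim_row A = dim_row A0"
  hence n0: "n0 = n" using dims by simp
  have "T * S = 1\<^sub>m n" using mat_mult_left_right_inverse[of S n T] ST n0 by simp
  hence "similar_mat_wit A A0 S T"
    using ST n0 dim by (intro similar_mat_witI[of _ _ n]) auto
  thus "char_poly A = char_poly A0" by (intro char_poly_similar) (auto simp: similar_mat_def)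
qed

subsection \<open>Removing an unobservable or uncontrollable mode\<close>

text \<open>\<open>v\<close> is completed to a basis, and Gram-Schmidt leaves its first vector
  unchanged.\<close>

lemma invertible_mat_first_col:
  fixes v :: "complex vec"
  assumes v: "v \<in> carrier_vec n" "v \<noteq> 0\<^sub>v n"
  obtains W V where "W \<in> carrier_mat n n" "V \<in> carrier_mat n n" "W * V = 1\<^sub>m n" "V * W = 1\<^sub>m n"
    "0 < n" "col W 0 = v"
proof -
  have n: "0 < n" using v by (cases n) (auto intro!: eq_vecI)
  interpret cof_vec_space n "TYPE(complex)" .
  define b where "b = basis_completion v"
  define ws where "ws = gram_schmidt n b"
  define W where "W = mat_of_cols n ws"
  define V where "V = corthogonal_inv W"
  from basis_completion[OF v, folded b_def]
  have dist_b: "distinct b" and indep: "\<not> lin_dep (set b)" and b: "set b \<subseteq> carrier_vec n"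
    and hdb: "hd b = v" and len_b: "length b = n" by auto
  from hdb len_b n obtain vs where bv: "b = v # vs" by (cases b) auto
  from gram_schmidt_result[OF b dist_b indep refl, folded ws_def]
  have ws: "set ws \<subseteq> carrier_vec n" "corthogonal ws" "length ws = n"
    by (auto simp: len_b)
  from gram_schmidt_hd[OF v(1), of vs, folded bv] have "hd ws = v" unfolding ws_def .
  hence ws0: "ws ! 0 = v" using ws n by (metis hd_conv_nth length_0_conv less_numeral_extra(3))
  have W: "W \<in> carrier_mat n n"
    using ws unfolding W_def using mat_of_cols_carrier(1)[of n ws] by auto
  have V: "V \<in> carrier_mat n n" unfolding V_def corthogonal_inv_def using W
    by (auto simp: mat_of_rows_def)
  from orthogonal_mat_of_cols[OF ws] have "corthogonal_mat W" unfolding W_def .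
  from corthogonal_inv_result[OF this] have VW: "V * W = 1\<^sub>m n"
    using V by (simp add: V_def inverts_mat_def)
  moreover have "col W 0 = v" unfolding W_def using ws0 ws n v col_mat_of_cols by metis
  ultimately show thesis using that W V n mat_mult_left_right_inverse[OF V W] by blast
qed

lemma realization_similar:
  assumes R: "realization G A B C D" and A: "A \<in> carrier_mat n n"
    and W: "W \<in> carrier_mat n n" "V \<in> carrier_mat n n" "W * V = 1\<^sub>m n"
  shows "realization G (V * A * W) (V * B) (C * W) D"
proof -
  obtain n' p m X where X: "solves A B X" "A \<in> carrier_mat n' n'" "B \<in> carrier_mat n' m"
    "C \<in> carrier_mat p n'" "D \<in> carrier_mat p m" "X \<in> carrier_mat n' m" "G = tf_const D + tf_const C * X"
    using R by (rule realizationE)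
  have d: "dim_row A = n" "dim_col A = n" "dim_row B = n" "dim_col B = m" "dim_row X = n" "dim_col X = m"
    "dim_row W = n" "dim_col W = n" "dim_row V = n" "dim_col V = n" "dim_row C = p" "dim_col C = n"
    using X(2-6) A W(1,2) by auto
  have WV: "tf_const W * (tf_const V * X) = X"
    using W d mult_assoc_mat[of "tf_const W" "tf_const V" X] left_mult_one_mat[OF X(6)] d carrier_matD[OF X(6)]
    by (simp add: tf_const_mult[symmetric])
  have "rat_s \<cdot>\<^sub>m (tf_const V * X) = tf_const V * (tf_const B + tf_const A * X)"
    using X(1) d by (simp add: mult_smult_mat[symmetric] solves_def)
  also have "\<dots> = tf_const (V * B) + tf_const (V * A * W) * (tf_const V * X)"
    using d by (simp add: mult_add_mat tf_const_mult mult_assoc_mat WV)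
  finally have "solves (V * A * W) (V * B) (tf_const V * X)"
    using d by (simp add: solves_def)
  moreover have "tf_const (C * W) * (tf_const V * X) = tf_const C * X"
    using d by (simp add: tf_const_mult mult_assoc_mat WV)
  ultimately show ?thesis
    using X(5,7) d realizationI[of "V * A * W" "V * B" "tf_const V * X" "C * W" p D]
      mult_carrier_mat[OF X(4), of W n] carrier_matD[OF X(4)] W(1) by simp
qed

text \<open>State 0 influences neither the other states nor the output, so the remaining rows of
  \<open>X\<close> solve a state equation of their own.\<close>

lemma realization_drop_first_state:
  assumes R: "realization G A B C D" and A: "A \<in> carrier_mat (Suc k) (Suc k)"
    and A0: "\<And>i. i < k \<Longrightarrow> A $$ (Suc i, 0) = 0" and C0: "\<And>i. i < dim_row C \<Longrightarrow> C $$ (i, 0) = 0"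
  shows "realization G (mat k k (\<lambda>(i,j). A $$ (Suc i, Suc j)))
    (mat k (dim_col B) (\<lambda>(i,j). B $$ (Suc i, j))) (mat (dim_row C) k (\<lambda>(i,j). C $$ (i, Suc j))) D"
    (is "realization G ?A ?B ?C D")
proof -
  obtain n p m X where X: "solves A B X" "A \<in> carrier_mat n n" "B \<in> carrier_mat n m"
    "C \<in> carrier_mat p n" "D \<in> carrier_mat p m" "X \<in> carrier_mat n m" "G = tf_const D + tf_const C * X"
    using R by (rule realizationE)
  have d: "dim_row A = Suc k" "dim_col A = Suc k" "dim_row B = Suc k" "dim_col B = m"
    "dim_row X = Suc k" "dim_col X = m" "dim_row C = p" "dim_col C = Suc k"
    using X(2-6) A by auto
  define Y where "Y = mat k m (\<lambda>(i,j). X $$ (Suc i, j))"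
  have "rat_s \<cdot>\<^sub>m Y = tf_const ?B + tf_const ?A * Y"
  proof (rule eq_matI)
    fix i j assume "i < dim_row (tf_const ?B + tf_const ?A * Y)" "j < dim_col (tf_const ?B + tf_const ?A * Y)"
    hence ij: "i < k" "j < m" by (auto simp: Y_def)
    have "(rat_s \<cdot>\<^sub>m Y) $$ (i,j) = (rat_s \<cdot>\<^sub>m X) $$ (Suc i, j)"
      using ij d by (simp add: Y_def)
    also have "\<dots> = (tf_const B + tf_const A * X) $$ (Suc i, j)"
      using X(1) by (simp add: solves_def)
    also have "\<dots> = rat_const (B $$ (Suc i, j)) + (\<Sum>l<Suc k. rat_const (A $$ (Suc i, l)) * X $$ (l, j))"
      using ij d by (simp add: scalar_prod_def atLeast0LessThan)
    also have "\<dots> = (tf_const ?B + tf_const ?A * Y) $$ (i,j)"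
      using ij d A0
      by (simp add: sum.lessThan_Suc_shift scalar_prod_def atLeast0LessThan Y_def del: sum.lessThan_Suc)
    finally show "(rat_s \<cdot>\<^sub>m Y) $$ (i,j) = (tf_const ?B + tf_const ?A * Y) $$ (i,j)" .
  qed (use d in \<open>auto simp: Y_def\<close>)
  hence "solves ?A ?B Y" using d by (simp add: solves_def Y_def)
  moreover have "tf_const C * X = tf_const ?C * Y"
  proof (rule eq_matI)
    fix i j assume "i < dim_row (tf_const ?C * Y)" "j < dim_col (tf_const ?C * Y)"
    hence ij: "i < p" "j < m" using d by (auto simp: Y_def)
    have "(tf_const C * X) $$ (i,j) = (\<Sum>l<Suc k. rat_const (C $$ (i, l)) * X $$ (l, j))"
      using ij d by (simp add: scalar_prod_def atLeast0LessThan)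
    also have "\<dots> = (tf_const ?C * Y) $$ (i,j)"
      using ij d C0
      by (simp add: sum.lessThan_Suc_shift scalar_prod_def atLeast0LessThan Y_def del: sum.lessThan_Suc)
    finally show "(tf_const C * X) $$ (i,j) = (tf_const ?C * Y) $$ (i,j)" .
  qed (use d in \<open>auto simp: Y_def\<close>)
  ultimately show ?thesis
    using X(5,7) d realizationI[of ?A ?B Y ?C p D] by auto
qed

text \<open>In a basis that starts with \<open>v\<close>, the mode is state 0: the first column of
  the new state matrix is \<open>z\<close> times a unit vector and that of the output matrix is
  zero. The block triangular shape splits off the factor \<open>s - z\<close>.\<close>

lemma unobservable_reduction:
  assumes R: "realization G A B C D" and A: "A \<in> carrier_mat n n"
    and v: "v \<in> carrier_vec n" "v \<noteq> 0\<^sub>v n" "A *\<^sub>v v = z \<cdot>\<^sub>v v" "C *\<^sub>v v = 0\<^sub>v (dim_row C)"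
  obtains A' B' C' where "realization G A' B' C' D" "Suc (dim_row A') = n"
    "char_poly A = [:-z, 1:] * char_poly A'"
proof -
  obtain W V where W: "W \<in> carrier_mat n n" "V \<in> carrier_mat n n" "W * V = 1\<^sub>m n" "V * W = 1\<^sub>m n"
    "0 < n" "col W 0 = v"
    using invertible_mat_first_col[OF v(1,2)] .
  then obtain k where n: "n = Suc k" by (cases n) auto
  have Vv: "V *\<^sub>v v = unit_vec n 0"
    using W col_mult2[OF W(2,1), of 0] by simp
  define F where "F = V * A * W"
  have F: "F \<in> carrier_mat n n" using W A by (simp add: F_def)
  have C: "C \<in> carrier_mat (dim_row C) n"
    using realization_dims(3)[OF R] A by auto
  have "col F 0 = V * A *\<^sub>v v"
    unfolding F_def using W A by (subst col_mult2[of _ n n]) auto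
  also have "\<dots> = V *\<^sub>v (z \<cdot>\<^sub>v v)"
    using W A v by (simp add: assoc_mult_mat_vec[of V n n A n v])
  also have "\<dots> = z \<cdot>\<^sub>v unit_vec n 0"
    using W v Vv by (simp add: mult_mat_vec)
  finally have col_F: "col F 0 = z \<cdot>\<^sub>v unit_vec n 0" .
  have col: "F $$ (i, 0) = (if i = 0 then z else 0)" if "i < n" for i
  proof -
    have "F $$ (i, 0) = col F 0 $ i" using that F by simp
    thus ?thesis using that W(5) unfolding col_F by simp
  qed
  have "col (C * W) 0 = 0\<^sub>v (dim_row C)"
    using col_mult2[OF C W(1) W(5)] W(6) v(4) by metis
  hence colC: "(C * W) $$ (i, 0) = 0" if "i < dim_row (C * W)" for i
    using that W(1) n by (metis carrier_matD(2) index_col index_mult_mat(2,3) index_zero_vec(1) zero_less_Suc)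
  define F' where "F' = mat k k (\<lambda>(i,j). F $$ (Suc i, Suc j))"
  have "realization G F (V * B) (C * W) D"
    unfolding F_def by (rule realization_similar[OF R A W(1-3)])
  hence "realization G F' (mat k (dim_col (V * B)) (\<lambda>(i,j). (V * B) $$ (Suc i, j)))
    (mat (dim_row (C * W)) k (\<lambda>(i,j). (C * W) $$ (i, Suc j))) D"
    unfolding F'_def
    by (rule realization_drop_first_state[OF _ F[unfolded n]]) (simp add: n col, erule colC)
  moreover have "char_poly A = [:-z, 1:] * char_poly F'"
  proof -
    have "similar_mat_wit F A V W"
      using W A F by (intro similar_mat_witI[of _ _ n]) (auto simp: F_def)
    hence "similar_mat F A" by (auto simp: similar_mat_def)
    hence "char_poly A = char_poly F" by (rule char_poly_similar[symmetric])
    also have "F = four_block_mat (mat 1 1 (\<lambda>_. z)) (mat 1 k (\<lambda>(i,j). F $$ (0, Suc j))) (0\<^sub>m k 1) F'"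
      using F n col by (intro eq_matI) (auto simp: F'_def)
    also have "char_poly \<dots> = char_poly (mat 1 1 (\<lambda>_. z)) * char_poly F'"
      by (intro char_poly_four_block_zeros_col[of _ _ k]) (simp_all add: F'_def)
    also have "char_poly (mat 1 1 (\<lambda>_. z)) = [:-z, 1:]"
      by (simp add: char_poly_defs det_def)
    finally show ?thesis .
  qed
  moreover have "Suc (dim_row F') = n" using n by (simp add: F'_def)
  ultimately show thesis using that by blast
qed

lemma uncontrollable_reduction:
  assumes R: "realization G A B C D" and A: "A \<in> carrier_mat n n"
    and v: "v \<in> carrier_vec n" "v \<noteq> 0\<^sub>v n" "transpose_mat A *\<^sub>v v = z \<cdot>\<^sub>v v"
      "transpose_mat B *\<^sub>v v = 0\<^sub>v (dim_col B)"
  obtains A' B' C' where "realization G A' B' C' D" "Suc (dim_row A') = n"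
    "char_poly A = [:-z, 1:] * char_poly A'"
proof -
  obtain A' B' C' where *: "realization (transpose_mat G) A' B' C' (transpose_mat D)"
    "Suc (dim_row A') = n" "char_poly (transpose_mat A) = [:-z, 1:] * char_poly A'"
    using unobservable_reduction[OF realization_transpose[OF R], of n v z] A v by auto
  have "A' \<in> carrier_mat (dim_row A') (dim_row A')" by (rule realization_dims[OF *(1)])
  hence "dim_row (transpose_mat A') = dim_row A'" "char_poly (transpose_mat A') = char_poly A'"
    by (metis carrier_matD(2) index_transpose_mat(2), rule char_poly_transpose_mat)
  thus thesis
    using that[OF realization_transpose[OF *(1), unfolded transpose_transpose]] *(2,3)
      char_poly_transpose_mat[OF A] by metis
qed

subsection \<open>Minimal realizations and pole multiplicities\<close>

definition realizable :: "tf \<Rightarrow> bool" where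
  "realizable G \<longleftrightarrow> (\<exists>A B C D. realization G A B C D)"

text \<open>State dimensions are natural numbers, so among the existing realizations one has least
  dimension; the \<open>SOME\<close> in \<open>min_real\<close> therefore has a witness.\<close>

lemma min_real:
  assumes "realizable G"
  obtains A B C D where "min_real G = (A, B, C, D)" "minimal_realization G A B C D"
proof -
  define P where "P = (\<lambda>(A, B, C, D). realization G A B C D)"
  obtain t where t: "P t" using assms by (auto simp: realizable_def P_def)
  obtain s where s: "P s" "\<And>t. P t \<Longrightarrow> dim_row (fst s) \<le> dim_row (fst t)"
    using ex_has_least_nat[of P t "\<lambda>t. dim_row (fst t)"] t by blast
  hence "\<exists>s. (\<lambda>(A, B, C, D). minimal_realization G A B C D) s"
    by (intro exI[of _ s]) (force simp: P_def minimal_realization_def split: prod.splits)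
  from someI_ex[OF this] have "(\<lambda>(A, B, C, D). minimal_realization G A B C D) (min_real G)"
    by (simp add: min_real_def)
  thus thesis using that by (auto split: prod.splits)
qed

text \<open>An eigenvector violating either test could be removed, leaving a realization with one
  state fewer.\<close>

lemma minimal_realization_pbh:
  assumes "minimal_realization G A B C D"
  shows "observable A C" "controllable A B"
proof -
  have R: "realization G A B C D"
    and min: "\<And>A' B' C' D'. realization G A' B' C' D' \<Longrightarrow> dim_row A \<le> dim_row A'"
    using assms by (auto simp: minimal_realization_def)
  note d = realization_dims[OF R]
  show "observable A C"
    unfolding observable_def
  proof (intro allI impI, rule ccontr)
    fix v z assume "v \<in> carrier_vec (dim_row A)" "A *\<^sub>v v = z \<cdot>\<^sub>v v" "C *\<^sub>v v = 0\<^sub>v (dim_row C)"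
      "v \<noteq> 0\<^sub>v (dim_row A)"
    then obtain A' B' C' where "realization G A' B' C' D" "Suc (dim_row A') = dim_row A"
      using unobservable_reduction[OF R d(1)] by metis
    thus False using min by fastforce
  qed
  have dT: "dim_row (transpose_mat A) = dim_row A" "dim_row (transpose_mat B) = dim_col B"
    using carrier_matD(2)[OF d(1)] by auto
  show "controllable A B"
    unfolding controllable_def observable_def dT
  proof (intro allI impI, rule ccontr)
    fix v z assume "v \<in> carrier_vec (dim_row A)" "transpose_mat A *\<^sub>v v = z \<cdot>\<^sub>v v"
      "transpose_mat B *\<^sub>v v = 0\<^sub>v (dim_col B)" "v \<noteq> 0\<^sub>v (dim_row A)"
    then obtain A' B' C' where "realization G A' B' C' D" "Suc (dim_row A') = dim_row A"
      using uncontrollable_reduction[OF R d(1)] by metis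
    thus False using min by fastforce
  qed
qed

text \<open>The chosen realization is no larger than \<open>A\<close> by minimality and no smaller
  by \<open>realization_compare\<close>, so the two characteristic polynomials coincide.\<close>

lemma pole_mult_eq:
  assumes "realization G A B C D" "observable A C" "controllable A B"
  shows "pole_mult G z = order z (char_poly A)"
proof -
  have "realizable G" using assms by (auto simp: realizable_def)
  then obtain A0 B0 C0 D0 where m: "min_real G = (A0, B0, C0, D0)" "minimal_realization G A0 B0 C0 D0"
    by (rule min_real)
  hence "realization G A0 B0 C0 D0" "dim_row A0 \<le> dim_row A"
    using assms by (auto simp: minimal_realization_def)
  with realization_compare[OF assms(1) _ assms(2,3)] have "char_poly A = char_poly A0"
    by (meson le_antisym)
  thus ?thesis by (simp add: pole_mult_def m)
qed

lemma char_poly_nonzero: "A \<in> carrier_mat n n \<Longrightarrow> char_poly A \<noteq> 0"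
  using degree_monic_char_poly[of A n] by auto

text \<open>As long as a test fails, a mode can be removed, which only divides the characteristic
  polynomial by a linear factor. The process stops at a realization that computes the multiplicity
  exactly.\<close>

lemma pole_mult_le:
  assumes "realization G A B C D"
  shows "pole_mult G z \<le> order z (char_poly A)"
  using assms
proof (induction "dim_row A" arbitrary: A B C rule: less_induct)
  case less
  define n where "n = dim_row A"
  note d = realization_dims[OF less.prems, folded n_def]
  show ?case
  proof (cases "observable A C \<and> controllable A B")
    case True
    thus ?thesis using pole_mult_eq[OF less.prems] by simp
  next
    case False
    have dT: "dim_row (transpose_mat A) = n" "dim_row (transpose_mat B) = dim_col B"
      using d by auto
    obtain A' B' C' u where *: "realization G A' B' C' D" "Suc (dim_row A') = n"
      "char_poly A = [:-u, 1:] * char_poly A'"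
    proof (cases "observable A C")
      case True
      with False have "\<not> controllable A B" by simp
      thus thesis
        using uncontrollable_reduction[OF less.prems d(1)] that
        unfolding controllable_def observable_def dT by metis
    next
      case False
      thus thesis
        using unobservable_reduction[OF less.prems d(1)] that
        unfolding observable_def n_def[symmetric] by metis
    qed
    have "pole_mult G z \<le> order z (char_poly A')"
      using less.hyps[of A' B' C'] * by (simp add: n_def)
    also have "\<dots> \<le> order z (char_poly A)"
      using *(3) char_poly_nonzero[OF d(1)] by (subst *(3), subst order_mult) simp_all
    finally show ?thesis .
  qed
qed

text \<open>Removing this mode costs exactly one factor \<open>s - z\<close>, and what remains is
  still an upper bound; this is where the strict inequality of a cancellation arises.\<close>

lemma pole_mult_uncontrollable:
  assumes R: "realization G A B C D" and A: "A \<in> carrier_mat n n"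
    and v: "v \<in> carrier_vec n" "v \<noteq> 0\<^sub>v n" "transpose_mat A *\<^sub>v v = z \<cdot>\<^sub>v v"
      "transpose_mat B *\<^sub>v v = 0\<^sub>v (dim_col B)"
  shows "pole_mult G z < order z (char_poly A)"
proof -
  obtain A' B' C' where *: "realization G A' B' C' D" "char_poly A = [:-z, 1:] * char_poly A'"
    using uncontrollable_reduction[OF R A v] by metis
  have "order z (char_poly A) = order z [:-z, 1:] + order z (char_poly A')"
    using char_poly_nonzero[OF A] unfolding *(2) by (rule order_mult)
  moreover have "order z [:-z, 1:] = 1" using order_power_n_n[of z 1] by simp
  ultimately show ?thesis using pole_mult_le[OF *(1), of z] by simp
qed

lemma realizable_transpose: "realizable G \<Longrightarrow> realizable (transpose_mat G)"
  unfolding realizable_def using realization_transpose by blast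

text \<open>Transposition exchanges the two eigenvector tests and preserves the characteristic
  polynomial.\<close>

lemma pole_mult_transpose:
  assumes "realizable G"
  shows "pole_mult (transpose_mat G) z = pole_mult G z"
proof -
  obtain A B C D where m: "min_real G = (A, B, C, D)" "minimal_realization G A B C D"
    using min_real[OF assms] .
  hence R: "realization G A B C D" by (simp add: minimal_realization_def)
  note pbh = minimal_realization_pbh[OF m(2)]
  have "pole_mult (transpose_mat G) z = order z (char_poly (transpose_mat A))"
    using pole_mult_eq[OF realization_transpose[OF R]] pbh by (simp add: controllable_def)
  also have "\<dots> = order z (char_poly A)"
    using char_poly_transpose_mat[OF realization_dims(1)[OF R]] by simp
  also have "\<dots> = pole_mult G z" using m by (simp add: pole_mult_def)
  finally show ?thesis .
qed

lemma tf_pole_iff: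
  assumes "realizable G"
  shows "tf_pole G z \<longleftrightarrow> pole_mult G z \<noteq> 0"
proof -
  obtain A B C D where m: "min_real G = (A, B, C, D)" "minimal_realization G A B C D"
    using min_real[OF assms] .
  hence A: "A \<in> carrier_mat (dim_row A) (dim_row A)"
    using realization_dims by (simp only: minimal_realization_def) blast
  show ?thesis
    using m eigenvalue_root_char_poly[OF A] char_poly_nonzero[OF A] order_root[of "char_poly A" z]
    by (simp add: tf_pole_def pole_mult_def)
qed

subsection \<open>Interconnections\<close>

lemma four_block_mult_append_rows:
  fixes A1 :: "'a :: semiring_1 mat"
  assumes "A1 \<in> carrier_mat p1 n1" "A2 \<in> carrier_mat p1 n2" "A3 \<in> carrier_mat p2 n1" "A4 \<in> carrier_mat p2 n2"
    "U \<in> carrier_mat n1 m" "V \<in> carrier_mat n2 m"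
  shows "four_block_mat A1 A2 A3 A4 * (U @\<^sub>r V) = (A1 * U + A2 * V) @\<^sub>r (A3 * U + A4 * V)"
proof -
  have "four_block_mat A1 A2 A3 A4 * (U @\<^sub>r V) =
    four_block_mat (A1 * U + A2 * V) (A1 * 0\<^sub>m n1 0 + A2 * 0\<^sub>m n2 0)
      (A3 * U + A4 * V) (A3 * 0\<^sub>m n1 0 + A4 * 0\<^sub>m n2 0)"
    unfolding append_rows_def using assms
    by (subst mult_four_block_mat[OF assms(1-5) _ assms(6)]) auto
  also have "\<dots> = (A1 * U + A2 * V) @\<^sub>r (A3 * U + A4 * V)"
    using assms by (intro eq_matI) (auto simp: append_rows_def)
  finally show ?thesis .
qed

lemma append_rows_empty [simp]: "dim_row V = 0 \<Longrightarrow> U @\<^sub>r V = U"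
  by (intro eq_matI) (auto simp: append_rows_index)

lemma append_rows_add:
  "dim_row U' = dim_row U \<Longrightarrow> dim_col U' = dim_col U \<Longrightarrow> dim_row V' = dim_row V \<Longrightarrow>
    dim_col V = dim_col U \<Longrightarrow> dim_col V' = dim_col U \<Longrightarrow>
    (U @\<^sub>r V) + (U' @\<^sub>r V') = (U + U') @\<^sub>r (V + V')"
  by (intro eq_matI) (auto simp: append_rows_index)

lemma append_rows_smult: "dim_col V = dim_col U \<Longrightarrow> k \<cdot>\<^sub>m (U @\<^sub>r V) = (k \<cdot>\<^sub>m U) @\<^sub>r (k \<cdot>\<^sub>m V)"
  by (intro eq_matI) (auto simp: append_rows_index)

lemma tf_const_append_rows: "dim_col V = dim_col U \<Longrightarrow> tf_const (U @\<^sub>r V) = tf_const U @\<^sub>r tf_const V"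
  by (intro eq_matI) (auto simp: append_rows_index)

lemma tf_const_four_block:
  assumes "A \<in> carrier_mat r1 c1" "B \<in> carrier_mat r1 c2" "C \<in> carrier_mat r2 c1" "D \<in> carrier_mat r2 c2"
  shows "tf_const (four_block_mat A B C D) = four_block_mat (tf_const A) (tf_const B) (tf_const C) (tf_const D)"
  unfolding tf_const_def using assms by (rule map_four_block_mat)

text \<open>The outer system is driven by the output \<open>Gi\<close> of the inner one, so its
  state is \<open>Xo * Gi\<close>, stacked on \<open>Xi\<close>. The blocks with 0 rows only write
  the row \<open>[Co, Do Ci]\<close> as a block matrix.\<close>

lemma realization_cascade:
  assumes Ro: "realization Go Ao Bo Co Do" and Ri: "realization Gi Ai Bi Ci Di"
    and io: "dim_col Go = dim_row Gi"
    and dims: "Ao \<in> carrier_mat n1 n1" "Ai \<in> carrier_mat n2 n2"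
  shows "realization (Go * Gi) (four_block_mat Ao (Bo * Ci) (0\<^sub>m n2 n1) Ai) ((Bo * Di) @\<^sub>r Bi)
    (four_block_mat Co (Do * Ci) (0\<^sub>m 0 n1) (0\<^sub>m 0 n2)) (Do * Di)"
proof -
  obtain n1' p k Xo where o: "solves Ao Bo Xo" "Ao \<in> carrier_mat n1' n1'" "Bo \<in> carrier_mat n1' k"
    "Co \<in> carrier_mat p n1'" "Do \<in> carrier_mat p k" "Xo \<in> carrier_mat n1' k"
    "Go = tf_const Do + tf_const Co * Xo" "dim_row Go = p" "dim_col Go = k"
    using Ro by (rule realizationE)
  obtain n2' k' m Xi where i: "solves Ai Bi Xi" "Ai \<in> carrier_mat n2' n2'" "Bi \<in> carrier_mat n2' m"
    "Ci \<in> carrier_mat k' n2'" "Di \<in> carrier_mat k' m" "Xi \<in> carrier_mat n2' m"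
    "Gi = tf_const Di + tf_const Ci * Xi" "dim_row Gi = k'" "dim_col Gi = m"
    using Ri by (rule realizationE)
  have [simp]: "n1' = n1" "n2' = n2" "k' = k" using o i dims io by auto
  note o = o[simplified] and i = i[simplified]
  have Gi: "Gi \<in> carrier_mat k m" using i by auto
  have eqs: "rat_s \<cdot>\<^sub>m Xo = tf_const Bo + tf_const Ao * Xo" "rat_s \<cdot>\<^sub>m Xi = tf_const Bi + tf_const Ai * Xi"
    using o(1) i(1) by (simp_all add: solves_def)
  define A B C X where "A = four_block_mat Ao (Bo * Ci) (0\<^sub>m n2 n1) Ai" and "B = (Bo * Di) @\<^sub>r Bi"
    and "C = four_block_mat Co (Do * Ci) (0\<^sub>m 0 n1) (0\<^sub>m 0 n2)" and "X = (Xo * Gi) @\<^sub>r Xi"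
  have tfA: "tf_const A = four_block_mat (tf_const Ao) (tf_const (Bo * Ci)) (0\<^sub>m n2 n1) (tf_const Ai)"
    unfolding A_def using o i by (subst tf_const_four_block[of _ n1 n1 _ n2 _ n2]) auto
  have tfC: "tf_const C = four_block_mat (tf_const Co) (tf_const (Do * Ci)) (0\<^sub>m 0 n1) (0\<^sub>m 0 n2)"
    unfolding C_def using o i by (subst tf_const_four_block[of _ p n1 _ n2 _ 0]) auto
  have XoGi: "Xo * Gi \<in> carrier_mat n1 m" using o Gi by auto
  note d = o(2-6)[THEN carrier_matD(1)] o(2-6)[THEN carrier_matD(2)]
    i(2-6)[THEN carrier_matD(1)] i(2-6)[THEN carrier_matD(2)] i(8,9)
  have Bo_Gi: "tf_const Bo * Gi = tf_const (Bo * Di) + tf_const (Bo * Ci) * Xi"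
    unfolding i(7) using d by (simp add: mult_add_mat tf_const_mult mult_assoc_mat)
  have Do_Gi: "tf_const Do * Gi = tf_const (Do * Di) + tf_const (Do * Ci) * Xi"
    unfolding i(7) using d by (simp add: mult_add_mat tf_const_mult mult_assoc_mat)
  have "rat_s \<cdot>\<^sub>m X = (rat_s \<cdot>\<^sub>m Xo * Gi) @\<^sub>r (rat_s \<cdot>\<^sub>m Xi)"
    unfolding X_def using d by (simp add: append_rows_smult smult_mult_mat)
  also have "rat_s \<cdot>\<^sub>m Xo * Gi = tf_const (Bo * Di) + (tf_const Ao * (Xo * Gi) + tf_const (Bo * Ci) * Xi)"
  proof -
    have "rat_s \<cdot>\<^sub>m Xo * Gi = tf_const Bo * Gi + tf_const Ao * (Xo * Gi)"
      using d by (simp add: eqs add_mult_mat mult_assoc_mat)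
    also have "\<dots> = tf_const (Bo * Di) + (tf_const Ao * (Xo * Gi) + tf_const (Bo * Ci) * Xi)"
      unfolding Bo_Gi using d by (intro eq_matI) (auto simp: ac_simps)
    finally show ?thesis .
  qed
  also have "rat_s \<cdot>\<^sub>m Xi = tf_const Bi + (0\<^sub>m n2 n1 * (Xo * Gi) + tf_const Ai * Xi)"
  proof -
    have "tf_const Ai * Xi \<in> carrier_mat n2 m" using i(2,6) by simp
    thus ?thesis using eqs left_mult_zero_mat[OF XoGi] by simp
  qed
  also have "(tf_const (Bo * Di) + (tf_const Ao * (Xo * Gi) + tf_const (Bo * Ci) * Xi)) @\<^sub>r \<dots> =
      tf_const B + tf_const A * X"
    unfolding tfA X_def B_def using o i XoGi d
    by (subst four_block_mult_append_rows[of _ n1 n1 _ n2 _ n2 _ _ m])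
      (auto simp: append_rows_add tf_const_append_rows)
  finally have "solves A B X"
    using d by (simp add: solves_def A_def B_def X_def)
  moreover have "C \<in> carrier_mat p (dim_row A)" "Do * Di \<in> carrier_mat p (dim_col B)"
    unfolding A_def B_def C_def by (intro carrier_matI; simp add: d)+
  ultimately have "realization (tf_const (Do * Di) + tf_const C * X) A B C (Do * Di)"
    by (rule realizationI)
  also have "tf_const C * X = tf_const Co * (Xo * Gi) + tf_const (Do * Ci) * Xi"
    unfolding tfC X_def using o i XoGi
    by (subst four_block_mult_append_rows[of _ p n1 _ n2 _ 0 _ _ m]) auto
  also have "tf_const (Do * Di) + \<dots> = tf_const Do * Gi + tf_const Co * (Xo * Gi)"
    unfolding Do_Gi using d by (intro eq_matI) (auto simp: ac_simps)
  also have "\<dots> = Go * Gi"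
    unfolding o(7) using d by (simp add: add_mult_mat mult_assoc_mat)
  finally show ?thesis unfolding A_def B_def C_def .
qed

lemma realizable_parallel:
  assumes R1: "realization G1 A1 B1 C1 D1" and R2: "realization G2 A2 B2 C2 D2"
    and dim: "dim_row G1 = dim_row G2" "dim_col G1 = dim_col G2"
  shows "realizable (G1 + G2)"
proof -
  obtain n1 p m X1 where 1: "solves A1 B1 X1" "A1 \<in> carrier_mat n1 n1" "B1 \<in> carrier_mat n1 m"
    "C1 \<in> carrier_mat p n1" "D1 \<in> carrier_mat p m" "X1 \<in> carrier_mat n1 m"
    "G1 = tf_const D1 + tf_const C1 * X1" "dim_row G1 = p" "dim_col G1 = m"
    using R1 by (rule realizationE)
  obtain n2 p' m' X2 where 2: "solves A2 B2 X2" "A2 \<in> carrier_mat n2 n2" "B2 \<in> carrier_mat n2 m'"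
    "C2 \<in> carrier_mat p' n2" "D2 \<in> carrier_mat p' m'" "X2 \<in> carrier_mat n2 m'"
    "G2 = tf_const D2 + tf_const C2 * X2" "dim_row G2 = p'" "dim_col G2 = m'"
    using R2 by (rule realizationE)
  have [simp]: "p' = p" "m' = m" using 1 2 dim by auto
  note 2 = 2[simplified]
  note d = 1(2-6)[THEN carrier_matD(1)] 1(2-6)[THEN carrier_matD(2)]
    2(2-6)[THEN carrier_matD(1)] 2(2-6)[THEN carrier_matD(2)]
  have eqs: "rat_s \<cdot>\<^sub>m X1 = tf_const B1 + tf_const A1 * X1" "rat_s \<cdot>\<^sub>m X2 = tf_const B2 + tf_const A2 * X2"
    using 1(1) 2(1) by (simp_all add: solves_def)
  define A B C X where "A = four_block_mat A1 (0\<^sub>m n1 n2) (0\<^sub>m n2 n1) A2" and "B = B1 @\<^sub>r B2"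
    and "C = four_block_mat C1 C2 (0\<^sub>m 0 n1) (0\<^sub>m 0 n2)" and "X = X1 @\<^sub>r X2"
  have tfA: "tf_const A = four_block_mat (tf_const A1) (0\<^sub>m n1 n2) (0\<^sub>m n2 n1) (tf_const A2)"
    unfolding A_def using 1 2 by (subst tf_const_four_block[of _ n1 n1 _ n2 _ n2]) auto
  have tfC: "tf_const C = four_block_mat (tf_const C1) (tf_const C2) (0\<^sub>m 0 n1) (0\<^sub>m 0 n2)"
    unfolding C_def using 1 2 by (subst tf_const_four_block[of _ p n1 _ n2 _ 0]) auto
  have "tf_const A * X = (tf_const A1 * X1) @\<^sub>r (tf_const A2 * X2)"
    unfolding tfA X_def using 1 2
    by (subst four_block_mult_append_rows[of _ n1 n1 _ n2 _ n2 _ _ m]) auto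
  hence "solves A B X"
    using d by (simp add: solves_def A_def B_def X_def append_rows_smult append_rows_add
        tf_const_append_rows eqs)
  moreover have "C \<in> carrier_mat p (dim_row A)" "D1 + D2 \<in> carrier_mat p (dim_col B)"
    unfolding A_def B_def C_def by (intro carrier_matI; simp add: d)+
  ultimately have "realization (tf_const (D1 + D2) + tf_const C * X) A B C (D1 + D2)"
    by (rule realizationI)
  also have "tf_const C * X = tf_const C1 * X1 + tf_const C2 * X2"
    unfolding tfC X_def using 1 2
    by (subst four_block_mult_append_rows[of _ p n1 _ n2 _ 0 _ _ m]) auto
  also have "tf_const (D1 + D2) + \<dots> = G1 + G2"
    unfolding 1(7) 2(7) using d by (intro eq_matI) (auto simp: ac_simps rat_const.hom_add)
  finally show ?thesis by (auto simp: realizable_def)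
qed

lemma realizable_add:
  "realizable G1 \<Longrightarrow> realizable G2 \<Longrightarrow> dim_row G1 = dim_row G2 \<Longrightarrow> dim_col G1 = dim_col G2 \<Longrightarrow>
    realizable (G1 + G2)"
  unfolding realizable_def[of G1] realizable_def[of G2] using realizable_parallel by blast

lemma realizable_mult:
  assumes "realizable G1" "realizable G2" "dim_col G1 = dim_row G2"
  shows "realizable (G1 * G2)"
  using assms realization_cascade realization_dims(1) unfolding realizable_def by metis

lemma realization_const:
  "realization (tf_const M) (0\<^sub>m 0 0) (0\<^sub>m 0 (dim_col M)) (0\<^sub>m (dim_row M) 0) M"
proof -
  have "solves (0\<^sub>m 0 0) (0\<^sub>m 0 (dim_col M)) (0\<^sub>m 0 (dim_col M))"
    by (auto simp: solves_def)
  hence "realization (tf_const M + tf_const (0\<^sub>m (dim_row M) 0) * 0\<^sub>m 0 (dim_col M))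
    (0\<^sub>m 0 0) (0\<^sub>m 0 (dim_col M)) (0\<^sub>m (dim_row M) 0) M"
    by (rule realizationI[where p = "dim_row M"]) (simp, simp only: index_zero_mat carrier_mat_triv)
  also have "tf_const M + tf_const (0\<^sub>m (dim_row M) 0) * 0\<^sub>m 0 (dim_col M) = tf_const M"
    by (intro eq_matI) (auto simp: scalar_prod_def)
  finally show ?thesis .
qed

lemma realizable_const: "realizable (tf_const M)"
  using realization_const unfolding realizable_def by blast

section \<open>Realizing proper matrices by partial fractions\<close>

lemma realizable_first_order: "realizable (Fract 1 [:-z, 1:] \<cdot>\<^sub>m 1\<^sub>m p)"
proof -
  define q where "q = Fract 1 [:-z, 1:]"
  have q: "rat_s * q = 1 + rat_const z * q"
    by (simp add: q_def rat_s_def rat_const_def One_fract_def eq_fract algebra_simps)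
  have "solves (z \<cdot>\<^sub>m 1\<^sub>m p) (1\<^sub>m p) (q \<cdot>\<^sub>m 1\<^sub>m p)"
  proof -
    have "tf_const (z \<cdot>\<^sub>m 1\<^sub>m p) = rat_const z \<cdot>\<^sub>m 1\<^sub>m p" by (intro eq_matI) auto
    hence "tf_const (z \<cdot>\<^sub>m 1\<^sub>m p) * (q \<cdot>\<^sub>m 1\<^sub>m p) = rat_const z \<cdot>\<^sub>m (q \<cdot>\<^sub>m 1\<^sub>m p)"
      by (simp add: smult_mult_mat)
    thus ?thesis using q unfolding solves_def by (auto intro!: eq_matI)
  qed
  from realizationI[OF this, of "1\<^sub>m p" p "0\<^sub>m p p"]
  have "realization (tf_const (0\<^sub>m p p) + tf_const (1\<^sub>m p) * (q \<cdot>\<^sub>m 1\<^sub>m p)) (z \<cdot>\<^sub>m 1\<^sub>m p) (1\<^sub>m p) (1\<^sub>m p) (0\<^sub>m p p)"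
    by simp
  also have "tf_const (0\<^sub>m p p) + tf_const (1\<^sub>m p) * (q \<cdot>\<^sub>m 1\<^sub>m p) = q \<cdot>\<^sub>m 1\<^sub>m p"
    by simp
  finally show ?thesis by (auto simp: realizable_def q_def)
qed

definition entry_mat :: "nat \<Rightarrow> nat \<Rightarrow> nat \<Rightarrow> nat \<Rightarrow> 'a :: zero \<Rightarrow> 'a mat" where
  "entry_mat p m i j q = mat p m (\<lambda>(a, b). if a = i \<and> b = j then q else 0)"

lemma entry_mat_dim [simp]: "dim_row (entry_mat p m i j q) = p" "dim_col (entry_mat p m i j q) = m"
  by (simp_all add: entry_mat_def)

text \<open>Splitting off one pole at a time: if \<open>b = (s - z) b'\<close> and \<open>a = (s - z) a' + c\<close>, then
  \<open>a / b = a' / b' + 1 / (s - z) * (c / b')\<close>.\<close>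

lemma realizable_entry_mat:
  assumes "b \<noteq> 0" "degree a \<le> degree b"
  shows "realizable (entry_mat p m i j (Fract a b))"
  using assms
proof (induction "degree b" arbitrary: a b)
  case 0
  then obtain a0 b0 where ab: "a = [:a0:]" "b = [:b0:]"
    by (metis degree_eq_zeroE le_zero_eq)
  hence "Fract a b = rat_const (a0 / b0)"
    using 0 by (simp add: rat_const_def eq_fract)
  hence "entry_mat p m i j (Fract a b) = tf_const (entry_mat p m i j (a0 / b0))"
    by (intro eq_matI) (auto simp: entry_mat_def)
  thus ?case using realizable_const by simp
next
  case (Suc n)
  have "degree b \<noteq> 0" using Suc.hyps by simp
  then obtain z where z: "poly b z = 0"
    using fundamental_theorem_of_algebra[of b] by (auto simp: constant_degree)
  then obtain b' where b: "b = [:-z, 1:] * b'" by (metis poly_eq_0_iff_dvd dvdE)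
  have "[:-z, 1:] dvd a - [:poly a z:]" by (simp flip: poly_eq_0_iff_dvd)
  then obtain a' where "a - [:poly a z:] = [:-z, 1:] * a'" by (metis dvdE)
  hence a: "a = [:-z, 1:] * a' + [:poly a z:]" by (simp add: algebra_simps)
  have b': "b' \<noteq> 0" using Suc.prems b by auto
  hence "degree b = Suc (degree b')" unfolding b by (subst degree_mult_eq) auto
  hence "degree b' = n" using Suc.hyps by simp
  note b' = b' this
  \<comment> \<open>Properness survives the splitting: \<open>(s - z) a'\<close> differs from
    \<open>a\<close> by a constant, so \<open>a'\<close> has degree at most \<open>n\<close>, the
    degree of \<open>b'\<close>.\<close>
  have a': "degree a' \<le> n"
  proof (cases "a' = 0")
    case False
    have "degree ([:-z, 1:] * a') \<le> max (degree a) (degree [:poly a z:])"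
      using \<open>a - [:poly a z:] = _\<close> degree_diff_le_max by metis
    moreover have "degree ([:-z, 1:] * a') = Suc (degree a')"
      using False by (subst degree_mult_eq) auto
    ultimately show ?thesis using Suc.hyps Suc.prems by simp
  qed simp
  define q where "q = Fract 1 [:-z, 1:]"
  have "Fract a b = Fract a' b' + q * Fract [:poly a z:] b'"
  proof -
    have "Fract (l * a' + c) (l * b') = Fract a' b' + Fract 1 l * Fract c b'" if "l \<noteq> 0" for l c
      using b' that by (simp add: eq_fract algebra_simps)
    from this[of "[:-z, 1:]" "[:poly a z:]"] show ?thesis
      unfolding q_def by (subst (1) a, subst b) (simp del: mult_fract add_fract)
  qed
  hence "entry_mat p m i j (Fract a b) =
    entry_mat p m i j (Fract a' b') + (q \<cdot>\<^sub>m 1\<^sub>m p) * entry_mat p m i j (Fract [:poly a z:] b')"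
    by (subst smult_mult_mat) (auto simp: entry_mat_def intro!: eq_matI)
  also have "realizable \<dots>"
    using Suc.hyps(1)[of b' a'] Suc.hyps(1)[of b' "[:poly a z:]"] b' a'
      realizable_first_order[of z p, folded q_def]
    by (intro realizable_add realizable_mult) auto
  finally show ?case .
qed

text \<open>The matrix is a finite sum of matrices with a single nonzero position; the induction
  adds one position at a time.\<close>

lemma realizable_proper:
  assumes "tf_proper G"
  shows "realizable G"
proof -
  define p m where "p = dim_row G" and "m = dim_col G"
  have *: "realizable (mat p m (\<lambda>x. if x \<in> S then G $$ x else 0))"
    if "finite S" "S \<subseteq> {..<p} \<times> {..<m}" for S
    using that
  proof (induction S)
    case empty
    have "mat p m (\<lambda>x. if x \<in> {} then G $$ x else 0) = tf_const (0\<^sub>m p m)"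
      by (intro eq_matI) auto
    thus ?case using realizable_const[of "0\<^sub>m p m"] by simp
  next
    case (insert x S)
    obtain i j where x: "x = (i, j)" by (cases x)
    hence "G $$ x \<in> elements_mat G" using insert.prems by (auto simp: p_def m_def)
    then obtain a b where ab: "b \<noteq> 0" "degree a \<le> degree b" "G $$ x = Fract a b"
      using assms unfolding tf_proper_def proper_rational_def by metis
    have "mat p m (\<lambda>y. if y \<in> insert x S then G $$ y else 0) =
      entry_mat p m i j (G $$ x) + mat p m (\<lambda>x. if x \<in> S then G $$ x else 0)"
      using insert.hyps x by (intro eq_matI) (auto simp: entry_mat_def)
    also have "realizable \<dots>"
      using insert realizable_entry_mat[OF ab(1,2)] ab(3) by (intro realizable_add) auto
    finally show ?case .
  qed
  have "mat p m (\<lambda>x. if x \<in> {..<p} \<times> {..<m} then G $$ x else 0) = G"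
    by (intro eq_matI) (auto simp: p_def m_def)
  with *[of "{..<p} \<times> {..<m}"] show ?thesis by simp
qed

subsection \<open>Pole directions\<close>

lemma mat_adjoint_dim [simp]: "dim_row (mat_adjoint M) = dim_col M" "dim_col (mat_adjoint M) = dim_row M"
  by (simp_all add: mat_adjoint_def)

lemma mat_adjoint_mult_vec:
  fixes M :: "complex mat"
  assumes "dim_vec v = dim_row M"
  shows "mat_adjoint M *\<^sub>v v = conjugate (transpose_mat M *\<^sub>v conjugate v)"
proof (rule eq_vecI)
  fix i assume "i < dim_vec (conjugate (transpose_mat M *\<^sub>v conjugate v))"
  hence i: "i < dim_col M" by simp
  have "row (mat_adjoint M) i = conjugate (col M i)"
    using i by (simp add: mat_adjoint_def)
  thus "(mat_adjoint M *\<^sub>v v) $ i = conjugate (transpose_mat M *\<^sub>v conjugate v) $ i"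
    using i assms by (simp add: scalar_prod_def)
qed simp

text \<open>The conjugates of the elements of \<open>pdir_i\<close>, with an arbitrary controllable and observable
  realization in place of the chosen one; plain transposes replace the adjoints.\<close>

definition input_direction :: "tf \<Rightarrow> complex \<Rightarrow> complex vec \<Rightarrow> bool" where
  "input_direction G z w \<longleftrightarrow> (\<exists>A B C D y. realization G A B C D \<and> observable A C \<and> controllable A B \<and>
     y \<in> carrier_vec (dim_row A) \<and> transpose_mat A *\<^sub>v y = z \<cdot>\<^sub>v y \<and> transpose_mat B *\<^sub>v y = w)"

lemma eigenvector_iff_kernel:
  fixes A :: "'a :: comm_ring_1 mat"
  assumes A: "A \<in> carrier_mat n n" and v: "v \<in> carrier_vec n"
  shows "(z \<cdot>\<^sub>m 1\<^sub>m n - A) *\<^sub>v v = 0\<^sub>v n \<longleftrightarrow> A *\<^sub>v v = z \<cdot>\<^sub>v v"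
proof -
  have "(z \<cdot>\<^sub>m 1\<^sub>m n - A) *\<^sub>v v = z \<cdot>\<^sub>m 1\<^sub>m n *\<^sub>v v - A *\<^sub>v v"
    using A v by (intro minus_mult_distrib_mat_vec) auto
  also have "z \<cdot>\<^sub>m 1\<^sub>m n *\<^sub>v v = z \<cdot>\<^sub>v v"
    using v by (auto intro!: eq_vecI)
  finally have *: "(z \<cdot>\<^sub>m 1\<^sub>m n - A) *\<^sub>v v = z \<cdot>\<^sub>v v - A *\<^sub>v v" .
  have "A *\<^sub>v v \<in> carrier_vec n" using A v by simp
  thus ?thesis unfolding * using v
    by (auto simp: vec_eq_iff simp del: index_mult_mat_vec)
qed

text \<open>If \<open>h\<close> lies in the kernel of the adjoint of \<open>z I - A\<close>, then
  \<open>y = conjugate h\<close> satisfies \<open>A^T y = z y\<close>, with \<open>z\<close> itself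
  as eigenvalue, and \<open>B^T y\<close> is the conjugate of \<open>B^* h\<close>.\<close>

lemma pdir_i_input_direction:
  assumes G: "realizable G" and u: "u \<in> pdir_i G z"
  shows "input_direction G z (conjugate u)"
proof -
  obtain A B C D where m: "min_real G = (A, B, C, D)" "minimal_realization G A B C D"
    using min_real[OF G] .
  hence R: "realization G A B C D" by (simp add: minimal_realization_def)
  define n k where "n = dim_row A" and "k = dim_col G"
  have A: "A \<in> carrier_mat n n" and B: "B \<in> carrier_mat n k"
    using realization_carrier[OF R n_def[symmetric] refl k_def[symmetric]] by simp_all
  obtain h where h: "u = mat_adjoint B *\<^sub>v h" "h \<in> mat_kernel (mat_adjoint (z \<cdot>\<^sub>m 1\<^sub>m n - A))"
    using u m by (auto simp: pdir_i_def n_def)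
  define y where "y = conjugate h"
  have h': "h \<in> carrier_vec n" "mat_adjoint (z \<cdot>\<^sub>m 1\<^sub>m n - A) *\<^sub>v h = 0\<^sub>v n"
    using h(2) A by (auto simp: mat_kernel_def)
  hence y: "y \<in> carrier_vec n" by (simp add: y_def)
  have "conjugate (transpose_mat (z \<cdot>\<^sub>m 1\<^sub>m n - A) *\<^sub>v y) = 0\<^sub>v n"
    using mat_adjoint_mult_vec[of h "z \<cdot>\<^sub>m 1\<^sub>m n - A"] h' A by (simp add: y_def)
  hence "transpose_mat (z \<cdot>\<^sub>m 1\<^sub>m n - A) *\<^sub>v y = 0\<^sub>v n"
    by (metis conjugate_id conjugate_zero_vec)
  also have "transpose_mat (z \<cdot>\<^sub>m 1\<^sub>m n - A) = z \<cdot>\<^sub>m 1\<^sub>m n - transpose_mat A"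
    using A by (auto intro!: eq_matI)
  finally have "transpose_mat A *\<^sub>v y = z \<cdot>\<^sub>v y"
    using eigenvector_iff_kernel[of "transpose_mat A" n y z] A y by simp
  moreover have "conjugate u = transpose_mat B *\<^sub>v y"
    using mat_adjoint_mult_vec[of h B] h h' B by (simp add: y_def)
  ultimately show ?thesis
    using R minimal_realization_pbh[OF m(2)] y unfolding input_direction_def n_def by metis
qed

text \<open>A right eigenvector of \<open>A\<close> is a left eigenvector of \<open>A^T\<close>, and
  \<open>C\<close> is the transpose of the input matrix of the dual system, so here nothing is
  conjugated.\<close>

lemma pdir_o_input_direction:
  assumes G: "realizable G" and u: "u \<in> pdir_o G z"
  shows "input_direction (transpose_mat G) z u"
proof -
  obtain A B C D where m: "min_real G = (A, B, C, D)" "minimal_realization G A B C D"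
    using min_real[OF G] .
  hence R: "realization G A B C D" by (simp add: minimal_realization_def)
  define n where "n = dim_row A"
  have A: "A \<in> carrier_mat n n" using realization_carrier(1)[OF R n_def[symmetric] refl refl] .
  obtain y where y: "u = C *\<^sub>v y" "y \<in> mat_kernel (z \<cdot>\<^sub>m 1\<^sub>m n - A)"
    using u m by (auto simp: pdir_o_def n_def)
  hence "y \<in> carrier_vec n" "A *\<^sub>v y = z \<cdot>\<^sub>v y"
    using A eigenvector_iff_kernel[OF A, of y z] by (auto simp: mat_kernel_def)
  moreover have "controllable (transpose_mat A) (transpose_mat C)" "observable (transpose_mat A) (transpose_mat B)"
    using minimal_realization_pbh[OF m(2)] by (simp_all add: controllable_def)
  moreover have "dim_row (transpose_mat A) = n" using A by simp
  ultimately show ?thesis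
    using realization_transpose[OF R] y(1) unfolding input_direction_def
    by (metis transpose_transpose)
qed

text \<open>Since 0 is always a direction, an intersection that differs from \<open>{0}\<close> must
  contain a nonzero vector.\<close>

lemma pdir_i_dim:
  assumes "realizable G" "G \<in> carrier_mat p m"
  shows "0\<^sub>v m \<in> pdir_i G z" "pdir_i G z \<subseteq> carrier_vec m"
proof -
  obtain A B C D where m: "min_real G = (A, B, C, D)" "minimal_realization G A B C D"
    using min_real[OF assms(1)] .
  hence R: "realization G A B C D" by (simp add: minimal_realization_def)
  define n where "n = dim_row A"
  have A: "A \<in> carrier_mat n n" and B: "B \<in> carrier_mat n m"
    using realization_carrier[OF R n_def[symmetric], of p m] assms(2) by simp_all
  have eq: "pdir_i G z = (\<lambda>v. mat_adjoint B *\<^sub>v v) ` mat_kernel (mat_adjoint (z \<cdot>\<^sub>m 1\<^sub>m n - A))"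
    using m by (simp add: pdir_i_def n_def)
  show "pdir_i G z \<subseteq> carrier_vec m"
    unfolding eq by (rule image_subsetI, rule carrier_vecI) (simp add: carrier_matD(2)[OF B])
  have "0\<^sub>v n \<in> mat_kernel (mat_adjoint (z \<cdot>\<^sub>m 1\<^sub>m n - A))"
    using A by (auto simp: mat_kernel_def scalar_prod_def intro!: eq_vecI)
  moreover have "mat_adjoint B *\<^sub>v 0\<^sub>v n = 0\<^sub>v m" using B by (auto simp: scalar_prod_def intro!: eq_vecI)
  ultimately show "0\<^sub>v m \<in> pdir_i G z" unfolding eq by (metis image_eqI)
qed

lemma pdir_o_dim:
  assumes "realizable G" "G \<in> carrier_mat p m"
  shows "0\<^sub>v p \<in> pdir_o G z" "pdir_o G z \<subseteq> carrier_vec p"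
proof -
  obtain A B C D where m: "min_real G = (A, B, C, D)" "minimal_realization G A B C D"
    using min_real[OF assms(1)] .
  hence R: "realization G A B C D" by (simp add: minimal_realization_def)
  define n where "n = dim_row A"
  have A: "A \<in> carrier_mat n n" and C: "C \<in> carrier_mat p n"
    using realization_carrier[OF R n_def[symmetric], of p m] assms(2) by simp_all
  have eq: "pdir_o G z = (\<lambda>v. C *\<^sub>v v) ` mat_kernel (z \<cdot>\<^sub>m 1\<^sub>m n - A)"
    using m by (simp add: pdir_o_def n_def)
  show "pdir_o G z \<subseteq> carrier_vec p"
    unfolding eq by (rule image_subsetI, rule carrier_vecI) (simp add: carrier_matD(1)[OF C])
  have "0\<^sub>v n \<in> mat_kernel (z \<cdot>\<^sub>m 1\<^sub>m n - A)"
    using A by (auto simp: mat_kernel_def scalar_prod_def intro!: eq_vecI)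
  moreover have "C *\<^sub>v 0\<^sub>v n = 0\<^sub>v p" using C by (auto simp: scalar_prod_def intro!: eq_vecI)
  ultimately show "0\<^sub>v p \<in> pdir_o G z" unfolding eq by (metis image_eqI)
qed

subsection \<open>Block diagonal transfer functions\<close>

text \<open>This is the shape produced by one unfolding of \<open>diag_block_mat\<close>, so facts
  on two blocks extend to lists by induction.\<close>

abbreviation block_diag :: "'a :: zero mat \<Rightarrow> 'a mat \<Rightarrow> 'a mat" where
  "block_diag M N \<equiv> four_block_mat M (0\<^sub>m (dim_row M) (dim_col N)) (0\<^sub>m (dim_row N) (dim_col M)) N"

lemma transpose_block_diag: "transpose_mat (block_diag M N) = block_diag (transpose_mat M) (transpose_mat N)"
  by (auto intro!: eq_matI)

lemma block_diag_mult:
  fixes M N :: "'a :: semiring_1 mat"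
  assumes "dim_col M = dim_row M'" "dim_col N = dim_row N'"
  shows "block_diag M N * block_diag M' N' = block_diag (M * M') (N * N')"
proof -
  have "block_diag M N * block_diag M' N' = block_diag (M * M') (N * N')"
    if "M \<in> carrier_mat a b" "M' \<in> carrier_mat b c" "N \<in> carrier_mat d e" "N' \<in> carrier_mat e f" for a b c d e f
    using that by (subst mult_four_block_mat[of _ a b _ e _ d _ _ c _ f]) simp_all
  thus ?thesis using assms by (metis carrier_mat_triv)
qed

lemma block_diag_mult_vec:
  fixes M N :: "'a :: semiring_1 mat"
  assumes "a \<in> carrier_vec (dim_col M)" "d \<in> carrier_vec (dim_col N)"
  shows "block_diag M N *\<^sub>v (a @\<^sub>v d) = (M *\<^sub>v a) @\<^sub>v (N *\<^sub>v d)"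
proof -
  have "block_diag M N *\<^sub>v (a @\<^sub>v d) = (M *\<^sub>v a) @\<^sub>v (N *\<^sub>v d)"
    if "M \<in> carrier_mat r c" "N \<in> carrier_mat r' c'" "a \<in> carrier_vec c" "d \<in> carrier_vec c'" for r c r' c'
    using that by (subst four_block_mat_mult_vec[of _ r c _ c' _ r']) auto
  thus ?thesis using assms by (metis carrier_mat_triv)
qed

lemma tf_const_block_diag: "tf_const (block_diag M N) = block_diag (tf_const M) (tf_const N)"
  by (auto intro!: eq_matI)

lemma realization_block_diag:
  assumes R1: "realization G1 A1 B1 C1 D1" and R2: "realization G2 A2 B2 C2 D2"
  shows "realization (block_diag G1 G2) (block_diag A1 A2) (block_diag B1 B2) (block_diag C1 C2) (block_diag D1 D2)"
proof -
  obtain n1 p1 m1 X1 where 1: "solves A1 B1 X1" "A1 \<in> carrier_mat n1 n1" "B1 \<in> carrier_mat n1 m1"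
    "C1 \<in> carrier_mat p1 n1" "D1 \<in> carrier_mat p1 m1" "X1 \<in> carrier_mat n1 m1"
    "G1 = tf_const D1 + tf_const C1 * X1"
    using R1 by (rule realizationE)
  obtain n2 p2 m2 X2 where 2: "solves A2 B2 X2" "A2 \<in> carrier_mat n2 n2" "B2 \<in> carrier_mat n2 m2"
    "C2 \<in> carrier_mat p2 n2" "D2 \<in> carrier_mat p2 m2" "X2 \<in> carrier_mat n2 m2"
    "G2 = tf_const D2 + tf_const C2 * X2"
    using R2 by (rule realizationE)
  note d = 1(2-6)[THEN carrier_matD(1)] 1(2-6)[THEN carrier_matD(2)]
    2(2-6)[THEN carrier_matD(1)] 2(2-6)[THEN carrier_matD(2)]
  have add: "block_diag M N + block_diag M' N' = block_diag (M + M') (N + N')"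
    if "dim_row M = dim_row M'" "dim_col M = dim_col M'" "dim_row N = dim_row N'" "dim_col N = dim_col N'"
    for M N M' N' :: tf
    using that by (auto intro!: eq_matI)
  have "rat_s \<cdot>\<^sub>m block_diag X1 X2 = block_diag (rat_s \<cdot>\<^sub>m X1) (rat_s \<cdot>\<^sub>m X2)"
    by (auto intro!: eq_matI)
  also have "\<dots> = tf_const (block_diag B1 B2) + tf_const (block_diag A1 A2) * block_diag X1 X2"
  proof -
    have "block_diag (tf_const A1) (tf_const A2) * block_diag X1 X2 =
        block_diag (tf_const A1 * X1) (tf_const A2 * X2)"
      by (rule block_diag_mult) (simp_all add: d)
    moreover have "block_diag (tf_const B1) (tf_const B2) + block_diag (tf_const A1 * X1) (tf_const A2 * X2) =
        block_diag (tf_const B1 + tf_const A1 * X1) (tf_const B2 + tf_const A2 * X2)"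
      by (rule add) (simp_all add: d)
    ultimately show ?thesis
      using 1(1) 2(1) unfolding tf_const_block_diag solves_def by metis
  qed
  finally have "solves (block_diag A1 A2) (block_diag B1 B2) (block_diag X1 X2)"
    using d by (simp add: solves_def)
  moreover have "block_diag C1 C2 \<in> carrier_mat (p1 + p2) (dim_row (block_diag A1 A2))"
    "block_diag D1 D2 \<in> carrier_mat (p1 + p2) (dim_col (block_diag B1 B2))"
    by (intro carrier_matI; simp add: d)+
  ultimately have "realization (tf_const (block_diag D1 D2) + tf_const (block_diag C1 C2) * block_diag X1 X2)
    (block_diag A1 A2) (block_diag B1 B2) (block_diag C1 C2) (block_diag D1 D2)"
    by (rule realizationI)
  also have "tf_const (block_diag D1 D2) + tf_const (block_diag C1 C2) * block_diag X1 X2 = block_diag G1 G2"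
  proof -
    have "block_diag (tf_const C1) (tf_const C2) * block_diag X1 X2 =
        block_diag (tf_const C1 * X1) (tf_const C2 * X2)"
      by (rule block_diag_mult) (simp_all add: d)
    moreover have "block_diag (tf_const D1) (tf_const D2) + block_diag (tf_const C1 * X1) (tf_const C2 * X2) =
        block_diag G1 G2"
      unfolding 1(7) 2(7) by (rule add) (simp_all add: d)
    ultimately show ?thesis unfolding tf_const_block_diag by metis
  qed
  finally show ?thesis .
qed

text \<open>Shared eigenvalues do no harm: both parts of \<open>v\<close> satisfy the eigenvector
  equation for the same \<open>z\<close>, possibly as zero vectors, and the separate outputs force
  each part to vanish.\<close>

lemma observable_block_diag:
  assumes dims: "A1 \<in> carrier_mat n1 n1" "A2 \<in> carrier_mat n2 n2" "dim_col C1 = n1" "dim_col C2 = n2"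
    and obs: "observable A1 C1" "observable A2 C2"
  shows "observable (block_diag A1 A2) (block_diag C1 C2)"
  unfolding observable_def
proof (intro allI impI)
  fix v z assume *: "v \<in> carrier_vec (dim_row (block_diag A1 A2))" "block_diag A1 A2 *\<^sub>v v = z \<cdot>\<^sub>v v"
    "block_diag C1 C2 *\<^sub>v v = 0\<^sub>v (dim_row (block_diag C1 C2))"
  define a d where "a = vec_first v n1" and "d = vec_last v n2"
  have ad: "a \<in> carrier_vec n1" "d \<in> carrier_vec n2" by (auto simp: a_def d_def)
  have v: "v = a @\<^sub>v d" using *(1) dims by (simp add: a_def d_def)
  have "block_diag A1 A2 *\<^sub>v v = (A1 *\<^sub>v a) @\<^sub>v (A2 *\<^sub>v d)"
    unfolding v using ad dims by (intro block_diag_mult_vec) auto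
  moreover have "z \<cdot>\<^sub>v v = (z \<cdot>\<^sub>v a) @\<^sub>v (z \<cdot>\<^sub>v d)"
    unfolding v by (auto intro!: eq_vecI)
  ultimately have "(A1 *\<^sub>v a) @\<^sub>v (A2 *\<^sub>v d) = (z \<cdot>\<^sub>v a) @\<^sub>v (z \<cdot>\<^sub>v d)"
    using *(2) by simp
  hence 1: "A1 *\<^sub>v a = z \<cdot>\<^sub>v a" "A2 *\<^sub>v d = z \<cdot>\<^sub>v d"
    using append_vec_eq[of "A1 *\<^sub>v a" n1 "z \<cdot>\<^sub>v a"] ad dims by auto
  have "block_diag C1 C2 *\<^sub>v v = (C1 *\<^sub>v a) @\<^sub>v (C2 *\<^sub>v d)"
    unfolding v using ad dims by (intro block_diag_mult_vec) auto
  moreover have "0\<^sub>v (dim_row (block_diag C1 C2)) = 0\<^sub>v (dim_row C1) @\<^sub>v 0\<^sub>v (dim_row C2)"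
    by (auto intro!: eq_vecI)
  ultimately have "(C1 *\<^sub>v a) @\<^sub>v (C2 *\<^sub>v d) = 0\<^sub>v (dim_row C1) @\<^sub>v 0\<^sub>v (dim_row C2)"
    using *(3) by metis
  hence 2: "C1 *\<^sub>v a = 0\<^sub>v (dim_row C1)" "C2 *\<^sub>v d = 0\<^sub>v (dim_row C2)"
    using append_vec_eq[OF carrier_vecI[of "C1 *\<^sub>v a"] zero_carrier_vec] by (metis dim_mult_mat_vec)+
  have "a = 0\<^sub>v n1" "d = 0\<^sub>v n2"
    using obs 1 2 ad dims by (auto simp: observable_def)
  thus "v = 0\<^sub>v (dim_row (block_diag A1 A2))"
    using v dims by (auto intro!: eq_vecI)
qed

text \<open>This is what admitting arbitrary realizations in \<open>input_direction\<close> is for: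
  the block diagonal realization passes both tests but need not be the one chosen for the composite
  system.\<close>

lemma input_direction_block_diag:
  assumes "input_direction G1 z w1" "input_direction G2 z w2"
  shows "input_direction (block_diag G1 G2) z (w1 @\<^sub>v w2)"
proof -
  obtain A1 B1 C1 D1 y1 where 1: "realization G1 A1 B1 C1 D1" "observable A1 C1" "controllable A1 B1"
    "y1 \<in> carrier_vec (dim_row A1)" "transpose_mat A1 *\<^sub>v y1 = z \<cdot>\<^sub>v y1" "transpose_mat B1 *\<^sub>v y1 = w1"
    using assms(1) unfolding input_direction_def by blast
  obtain A2 B2 C2 D2 y2 where 2: "realization G2 A2 B2 C2 D2" "observable A2 C2" "controllable A2 B2"
    "y2 \<in> carrier_vec (dim_row A2)" "transpose_mat A2 *\<^sub>v y2 = z \<cdot>\<^sub>v y2" "transpose_mat B2 *\<^sub>v y2 = w2"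
    using assms(2) unfolding input_direction_def by blast
  define n1 n2 where "n1 = dim_row A1" and "n2 = dim_row A2"
  have d: "dim_row A1 = n1" "dim_col A1 = n1" "dim_row B1 = n1" "dim_col C1 = n1"
    "dim_row A2 = n2" "dim_col A2 = n2" "dim_row B2 = n2" "dim_col C2 = n2"
    using realization_carrier(1-3)[OF 1(1) n1_def[symmetric] refl refl]
      realization_carrier(1-3)[OF 2(1) n2_def[symmetric] refl refl] by (meson carrier_matD)+
  have y: "y1 \<in> carrier_vec n1" "y2 \<in> carrier_vec n2" using 1(4) 2(4) by (auto simp: n1_def n2_def)
  let ?A = "block_diag A1 A2" and ?B = "block_diag B1 B2" and ?C = "block_diag C1 C2" and ?y = "y1 @\<^sub>v y2"
  have "observable ?A ?C"
    by (rule observable_block_diag[of _ n1 _ n2]) (simp_all only: 1(2) 2(2) d carrier_matI)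
  moreover have "controllable ?A ?B"
    unfolding controllable_def transpose_block_diag
    by (rule observable_block_diag[of _ n1 _ n2])
      (simp_all only: 1(3)[unfolded controllable_def] 2(3)[unfolded controllable_def] d carrier_matI
        index_transpose_mat)
  moreover have "transpose_mat ?A *\<^sub>v ?y = z \<cdot>\<^sub>v ?y"
  proof -
    have "transpose_mat ?A *\<^sub>v ?y = (z \<cdot>\<^sub>v y1) @\<^sub>v (z \<cdot>\<^sub>v y2)"
      unfolding transpose_block_diag 1(5)[symmetric] 2(5)[symmetric] using d y
      by (intro block_diag_mult_vec) auto
    also have "\<dots> = z \<cdot>\<^sub>v ?y" using y by (auto intro!: eq_vecI)
    finally show ?thesis .
  qed
  moreover have "transpose_mat ?B *\<^sub>v ?y = w1 @\<^sub>v w2"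
    unfolding transpose_block_diag 1(6)[symmetric] 2(6)[symmetric] using d y
    by (intro block_diag_mult_vec) auto
  moreover have "?y \<in> carrier_vec (dim_row ?A)" using y d by simp
  ultimately show ?thesis
    using realization_block_diag[OF 1(1) 2(1)] unfolding input_direction_def by blast
qed

text \<open>The Kronecker product of the all-ones vector of length \<open>n\<close> with
  \<open>w\<close>.\<close>

definition stack_vec :: "nat \<Rightarrow> 'a vec \<Rightarrow> 'a vec" where
  "stack_vec n w = vec (n * dim_vec w) (\<lambda>i. w $ (i mod dim_vec w))"

lemma stack_vec_Suc: "stack_vec (Suc n) w = w @\<^sub>v stack_vec n w"
proof (rule eq_vecI)
  fix i assume "i < dim_vec (w @\<^sub>v stack_vec n w)"
  thus "stack_vec (Suc n) w $ i = (w @\<^sub>v stack_vec n w) $ i"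
    by (cases "i < dim_vec w") (auto simp: stack_vec_def le_mod_geq)
qed (simp add: stack_vec_def)

lemma input_direction_diag_block_mat:
  assumes "\<And>G. G \<in> set Gs \<Longrightarrow> input_direction G z w"
  shows "input_direction (diag_block_mat Gs) z (stack_vec (length Gs) w)"
  using assms
proof (induction Gs)
  case Nil
  have "realization (tf_const (0\<^sub>m 0 0)) (0\<^sub>m 0 0) (0\<^sub>m 0 0) (0\<^sub>m 0 0) (0\<^sub>m 0 0)"
    using realization_const[of "0\<^sub>m 0 0"] by simp
  moreover have "stack_vec 0 w = 0\<^sub>v 0" by (auto simp: stack_vec_def)
  ultimately show ?case
    unfolding input_direction_def
    by (intro exI[of _ "0\<^sub>m 0 0"] exI[of _ "0\<^sub>v 0"]) (auto simp: observable_def controllable_def intro!: eq_vecI)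
next
  case (Cons G Gs)
  have "input_direction G z w" "input_direction (diag_block_mat Gs) z (stack_vec (length Gs) w)"
    using Cons by auto
  from input_direction_block_diag[OF this] show ?case
    by (simp add: stack_vec_Suc Let_def)
qed

lemma diag_block_mat_carrier:
  "(\<And>G. G \<in> set Gs \<Longrightarrow> G \<in> carrier_mat p m) \<Longrightarrow>
    diag_block_mat Gs \<in> carrier_mat (length Gs * p) (length Gs * m)"
  by (induction Gs) (auto simp: Let_def)

lemma diag_block_mat_transpose:
  "transpose_mat (diag_block_mat Gs) = diag_block_mat (map transpose_mat Gs)"
  by (induction Gs) (simp_all add: Let_def transpose_block_diag)

lemma tf_proper_diag_block:
  "tf_proper (diag_block_mat Gs) \<Longrightarrow> G \<in> set Gs \<Longrightarrow> tf_proper G"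
proof (induction Gs)
  case (Cons H Gs)
  let ?N = "diag_block_mat Gs"
  have "elements_mat H \<subseteq> elements_mat (block_diag H ?N)"
  proof
    fix x assume "x \<in> elements_mat H"
    then obtain i j where "i < dim_row H" "j < dim_col H" "x = H $$ (i,j)" by (auto dest: elements_matD)
    thus "x \<in> elements_mat (block_diag H ?N)"
      by (intro elements_matI[OF carrier_mat_triv, of i _ j]) auto
  qed
  moreover have "elements_mat ?N \<subseteq> elements_mat (block_diag H ?N)"
  proof
    fix x assume "x \<in> elements_mat ?N"
    then obtain i j where "i < dim_row ?N" "j < dim_col ?N" "x = ?N $$ (i,j)" by (auto dest: elements_matD)
    thus "x \<in> elements_mat (block_diag H ?N)"
      by (intro elements_matI[OF carrier_mat_triv, of "i + dim_row H" _ "j + dim_col H"]) auto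
  qed
  ultimately show ?case using Cons by (auto simp: tf_proper_def Let_def)
qed simp

subsection \<open>Cancellation in a cascade\<close>

text \<open>\<open>W K = 0\<close> splits at infinity into \<open>W D = 0\<close> and
  \<open>W C X = 0\<close>. The second says that the output matrix \<open>W C\<close> is
  indistinguishable from 0, and left invertibility of the dual observability matrix, which is
  controllability, forces \<open>W C = 0\<close>.\<close>

lemma annihilated_output:
  assumes R: "realization K A B C D" and ctr: "controllable A B" and W: "dim_col W = dim_row K"
    and WK: "tf_const W * K = 0\<^sub>m (dim_row W) (dim_col K)"
  shows "W * C = 0\<^sub>m (dim_row W) (dim_row A)" "W * D = 0\<^sub>m (dim_row W) (dim_col K)"
proof -
  define r where "r = dim_row W"
  obtain n p m X where X: "solves A B X" "A \<in> carrier_mat n n" "B \<in> carrier_mat n m"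
    "C \<in> carrier_mat p n" "D \<in> carrier_mat p m" "X \<in> carrier_mat n m" "K = tf_const D + tf_const C * X"
    and dK: "dim_row K = p" "dim_col K = m"
    using R by (rule realizationE)
  have W': "W \<in> carrier_mat r p" using W dK by (auto simp: r_def)
  interpret solution_pair A B A B X X n n m
    using X by unfold_locales auto
  note d = dims X(4,5)[THEN carrier_matD(1)] X(4,5)[THEN carrier_matD(2)] carrier_matD[OF W']
  have eq: "tf_const (W * D) + tf_const (W * C) * X = tf_const (0\<^sub>m r m) + 0\<^sub>m r m"
  proof -
    have "tf_const (W * D) + tf_const (W * C) * X = tf_const W * K"
      unfolding X(7) using d by (simp add: mult_add_mat tf_const_mult mult_assoc_mat)
    thus ?thesis using WK dK by (simp add: r_def)
  qed
  have sp: "strictly_proper_mat (tf_const (W * C) * X)"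
    using sol(1)[THEN solves_strictly_proper] d by (intro strictly_proper_const_mult) auto
  have sp0: "strictly_proper_mat (0\<^sub>m r m)"
    by (simp add: strictly_proper_mat_def deg_le_0)
  note * = const_plus_strictly_proper_unique[OF eq sp sp0]
  show "W * D = 0\<^sub>m (dim_row W) (dim_col K)"
    using *(1) d dK by simp
  \<comment> \<open>The system is compared with itself, under the output matrices
    \<open>W * C\<close> and 0.\<close>
  have "equal_outputs (W * C) (0\<^sub>m r n)"
    using *(2) d left_mult_zero_mat[OF X(6), of r] by (simp add: equal_outputs_def)
  define Q where "Q = obs_mat (transpose_mat A) (transpose_mat B) n"
  have Q: "Q \<in> carrier_mat (n * m) n" using d by (auto simp: Q_def intro!: carrier_matI)
  have "Q * transpose_mat (W * C) = Q * transpose_mat (0\<^sub>m r n)"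
    using equal_outputs_ctrl_mat[OF \<open>equal_outputs (W * C) (0\<^sub>m r n)\<close>, of n] by (simp add: Q_def)
  hence Q0: "Q * transpose_mat (W * C) = 0\<^sub>m (n * m) r"
    using right_mult_zero_mat[OF Q, of r] by simp
  have "transpose_mat A \<in> carrier_mat n n" "transpose_mat B \<in> carrier_mat m n" using X by auto
  then obtain L where L: "L \<in> carrier_mat n (n * m)" "L * Q = 1\<^sub>m n"
    using obs_mat_left_inverse ctr unfolding Q_def controllable_def by metis
  have WC: "transpose_mat (W * C) \<in> carrier_mat n r" using W' X(4) by simp
  have "transpose_mat (W * C) = L * Q * transpose_mat (W * C)"
    unfolding L(2) by (rule left_mult_one_mat[OF WC, symmetric])
  also have "\<dots> = L * (Q * transpose_mat (W * C))"
    by (rule assoc_mult_mat[OF L(1) Q WC])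
  also have "\<dots> = 0\<^sub>m n r" unfolding Q0 by (rule right_mult_zero_mat[OF L(1)])
  finally have "transpose_mat (transpose_mat (W * C)) = 0\<^sub>m r n" by simp
  thus "W * C = 0\<^sub>m (dim_row W) (dim_row A)" using d by simp
qed

text \<open>The left eigenvector \<open>y\<close> of \<open>P\<close>, padded with zeros, is a left eigenvector of the cascade
  that is orthogonal to its inputs, because \<open>w = B\<^sup>T y\<close> annihilates everything \<open>K\<close> can output.\<close>

lemma cascade_cancellation:
  assumes P: "input_direction P z w" and w: "w \<noteq> 0\<^sub>v k" and K: "realizable K"
    and dim: "dim_col P = k" "dim_row K = k"
    and wK: "tf_const (mat_of_rows k [w]) * K = 0\<^sub>m 1 (dim_col K)"
  shows "pole_mult (P * K) z < pole_mult P z + pole_mult K z"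
proof -
  obtain A B C D y where p: "realization P A B C D" "observable A C" "controllable A B"
    "y \<in> carrier_vec (dim_row A)" "transpose_mat A *\<^sub>v y = z \<cdot>\<^sub>v y" "transpose_mat B *\<^sub>v y = w"
    using P unfolding input_direction_def by blast
  obtain AK BK CK DK where m: "minimal_realization K AK BK CK DK"
    using min_real[OF K] by metis
  hence q: "realization K AK BK CK DK" by (simp add: minimal_realization_def)
  note pbh = minimal_realization_pbh[OF m]
  define n nK r where "n = dim_row A" and "nK = dim_row AK" and "r = dim_col K"
  have c: "A \<in> carrier_mat n n" "B \<in> carrier_mat n k" "AK \<in> carrier_mat nK nK"
    "BK \<in> carrier_mat nK r" "CK \<in> carrier_mat k nK" "DK \<in> carrier_mat k r" "y \<in> carrier_vec n"
    using realization_carrier[OF p(1) n_def[symmetric] refl dim(1)]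
      realization_carrier[OF q nK_def[symmetric] dim(2) r_def[symmetric]] p(4)[folded n_def]
    by simp_all
  have wk: "w \<in> carrier_vec k" using p(6) c by auto
  have ann: "transpose_mat M *\<^sub>v w = 0\<^sub>v j"
    if "mat_of_rows k [w] * M = 0\<^sub>m 1 j" "M \<in> carrier_mat k j" for M j
  proof (rule eq_vecI)
    fix i assume "i < dim_vec (0\<^sub>v j :: complex vec)"
    hence i: "i < j" by simp
    have "col M i \<bullet> w = w \<bullet> col M i" using that(2) wk by (intro comm_scalar_prod[of _ k]) auto
    also have "\<dots> = (mat_of_rows k [w] * M) $$ (0, i)" using that(2) i wk by simp
    finally show "(transpose_mat M *\<^sub>v w) $ i = 0\<^sub>v j $ i" using that i by simp
  qed (use that in auto)
  have CKw: "transpose_mat CK *\<^sub>v w = 0\<^sub>v nK" and DKw: "transpose_mat DK *\<^sub>v w = 0\<^sub>v r"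
  proof -
    have "mat_of_rows k [w] * CK = 0\<^sub>m 1 nK" "mat_of_rows k [w] * DK = 0\<^sub>m 1 r"
      using annihilated_output[OF q pbh(2), of "mat_of_rows k [w]", folded nK_def r_def] wK dim(2)
      unfolding r_def[symmetric] by simp_all
    thus "transpose_mat CK *\<^sub>v w = 0\<^sub>v nK" "transpose_mat DK *\<^sub>v w = 0\<^sub>v r"
      using c by (blast intro: ann)+
  qed
  define F H where "F = four_block_mat A (B * CK) (0\<^sub>m nK n) AK" and "H = (B * DK) @\<^sub>r BK"
  define v where "v = y @\<^sub>v 0\<^sub>v nK"
  have R: "realization (P * K) F H (four_block_mat C (D * CK) (0\<^sub>m 0 n) (0\<^sub>m 0 nK)) (D * DK)"
    unfolding F_def H_def using realization_cascade[OF p(1) q] dim c by simp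
  have F: "F \<in> carrier_mat (n + nK) (n + nK)" using c by (simp add: F_def)
  have v: "v \<in> carrier_vec (n + nK)" using c by (simp add: v_def)
  \<comment> \<open>\<open>B^T y = w\<close> is nonzero, hence so is \<open>y\<close>.\<close>
  have "y \<noteq> 0\<^sub>v n" using p(6) w c by (auto intro!: eq_vecI)
  moreover have "0\<^sub>v (n + nK) = 0\<^sub>v n @\<^sub>v 0\<^sub>v nK" by (auto intro!: eq_vecI)
  ultimately have v0: "v \<noteq> 0\<^sub>v (n + nK)"
    using append_vec_eq[OF c(7) zero_carrier_vec] unfolding v_def by metis
  have assoc: "transpose_mat (B * M) *\<^sub>v y = transpose_mat M *\<^sub>v w" if "dim_row M = k" for M
    using c that p(6) by (simp add: transpose_mult_mat mult_assoc_mat_vec)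
  have "transpose_mat F = four_block_mat (transpose_mat A) (0\<^sub>m n nK) (transpose_mat (B * CK)) (transpose_mat AK)"
    unfolding F_def using c by (subst transpose_four_block_mat[of _ n n _ nK _ nK]) auto
  also have "\<dots> *\<^sub>v v = (transpose_mat A *\<^sub>v y + 0\<^sub>m n nK *\<^sub>v 0\<^sub>v nK) @\<^sub>v
      (transpose_mat (B * CK) *\<^sub>v y + transpose_mat AK *\<^sub>v 0\<^sub>v nK)"
    unfolding v_def using c by (intro four_block_mat_mult_vec) auto
  also have "\<dots> = z \<cdot>\<^sub>v v"
    using c CKw assoc[of CK] p(5) by (auto simp: v_def scalar_prod_def intro!: eq_vecI)
  finally have Fv: "transpose_mat F *\<^sub>v v = z \<cdot>\<^sub>v v" .
  \<comment> \<open>\<open>H\<close> is a block matrix whose right column of blocks has width 0;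
    after transposition the lower blocks have no rows and contribute an empty tail.\<close>
  have "transpose_mat H = four_block_mat (transpose_mat (B * DK)) (transpose_mat BK) (0\<^sub>m 0 n) (0\<^sub>m 0 nK)"
    unfolding H_def append_rows_def using c by (subst transpose_four_block_mat[of _ n r _ 0 _ nK]) auto
  also have "\<dots> *\<^sub>v v = (transpose_mat (B * DK) *\<^sub>v y + transpose_mat BK *\<^sub>v 0\<^sub>v nK) @\<^sub>v
      (0\<^sub>m 0 n *\<^sub>v y + 0\<^sub>m 0 nK *\<^sub>v 0\<^sub>v nK)"
    unfolding v_def using c by (intro four_block_mat_mult_vec) auto
  also have "\<dots> = 0\<^sub>v r"
    using c DKw assoc[of DK] by (auto simp: scalar_prod_def intro!: eq_vecI)
  finally have Hv: "transpose_mat H *\<^sub>v v = 0\<^sub>v (dim_col H)" using c by (simp add: H_def)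
  have "pole_mult (P * K) z < order z (char_poly F)"
    by (rule pole_mult_uncontrollable[OF R F v v0 Fv Hv])
  \<comment> \<open>\<open>F\<close> is block triangular, so the cascade realization carries the
    poles of \<open>P\<close> and of \<open>K\<close> together, and losing one factor drops below
    the sum of multiplicities.\<close>
  also have "char_poly F = char_poly A * char_poly AK"
    using char_poly_factorized[OF c(1)] char_poly_factorized[OF c(3)] c
    by (intro char_poly_0_block[OF F_def]) auto
  also have "order z \<dots> = order z (char_poly A) + order z (char_poly AK)"
    using char_poly_nonzero c by (intro order_mult) auto
  also have "\<dots> = pole_mult P z + pole_mult K z"
    using pole_mult_eq[OF p(1-3)] pole_mult_eq[OF q pbh] by simp
  finally show ?thesis .
qed

subsection \<open>Networks\<close>

lemma kronecker_dim [simp]: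
  "dim_row (X \<otimes>\<^sub>K Y) = dim_row X * dim_row Y" "dim_col (X \<otimes>\<^sub>K Y) = dim_col X * dim_col Y"
  by (simp_all add: kronecker_mat_def)

lemma transpose_kronecker: "transpose_mat (X \<otimes>\<^sub>K Y) = transpose_mat X \<otimes>\<^sub>K transpose_mat Y"
proof (rule eq_matI)
  fix i j assume "i < dim_row (transpose_mat X \<otimes>\<^sub>K transpose_mat Y)"
    "j < dim_col (transpose_mat X \<otimes>\<^sub>K transpose_mat Y)"
  moreover from this have "0 < dim_col Y" "0 < dim_row Y" by (auto intro: Nat.gr0I)
  ultimately show "transpose_mat (X \<otimes>\<^sub>K Y) $$ (i,j) = (transpose_mat X \<otimes>\<^sub>K transpose_mat Y) $$ (i,j)"
    by (simp add: kronecker_mat_def less_mult_imp_div_less)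
qed simp_all

lemma tf_const_kronecker: "tf_const (X \<otimes>\<^sub>K Y) = tf_const X \<otimes>\<^sub>K tf_const Y"
proof (rule eq_matI)
  fix i j assume "i < dim_row (tf_const X \<otimes>\<^sub>K tf_const Y)" "j < dim_col (tf_const X \<otimes>\<^sub>K tf_const Y)"
  moreover from this have "0 < dim_col Y" "0 < dim_row Y" by (auto intro: Nat.gr0I)
  ultimately show "tf_const (X \<otimes>\<^sub>K Y) $$ (i,j) = (tf_const X \<otimes>\<^sub>K tf_const Y) $$ (i,j)"
    by (simp add: kronecker_mat_def less_mult_imp_div_less rat_const.hom_mult)
qed simp_all

lemma sum_div_mod:
  fixes f :: "nat \<Rightarrow> nat \<Rightarrow> 'a :: comm_monoid_add"
  shows "(\<Sum>i<a * b. f (i div b) (i mod b)) = (\<Sum>x<a. \<Sum>y<b. f x y)"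
proof -
  have "(\<Sum>i<a * b. f (i div b) (i mod b)) = (\<Sum>x<a. \<Sum>i\<in>{x * b..<x * b + b}. f (i div b) (i mod b))"
    by (rule sum.nat_group[symmetric])
  also have "\<dots> = (\<Sum>x<a. \<Sum>y<b. f x y)"
  proof (rule sum.cong[OF refl])
    fix x
    have "(\<Sum>i\<in>{x * b..<x * b + b}. f (i div b) (i mod b)) = (\<Sum>y\<in>{0..<b}. f ((y + x * b) div b) ((y + x * b) mod b))"
      using sum.shift_bounds_nat_ivl[of "\<lambda>i. f (i div b) (i mod b)" 0 "x * b" b] by (simp add: add.commute)
    thus "(\<Sum>i\<in>{x * b..<x * b + b}. f (i div b) (i mod b)) = (\<Sum>y<b. f x y)"
      by (simp add: atLeast0LessThan)
  qed
  finally show ?thesis .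
qed

text \<open>The mixed product rule: the left side is the Kronecker product of the row of column sums
  of \<open>E\<close> with \<open>w^T\<close>. In coordinates the identity block selects the entry
  \<open>w $ b\<close>, which then multiplies a column sum.\<close>

lemma stack_vec_kronecker_one:
  fixes E :: "'a :: comm_ring_1 mat"
  assumes E: "E \<in> carrier_mat n e" and sum: "\<And>j. j < e \<Longrightarrow> (\<Sum>i<n. E $$ (i,j)) = 0"
    and w: "w \<in> carrier_vec m"
  shows "mat_of_rows (n * m) [stack_vec n w] * (E \<otimes>\<^sub>K 1\<^sub>m m) = 0\<^sub>m 1 (e * m)"
proof (rule eq_matI)
  fix i j assume "i < dim_row (0\<^sub>m 1 (e * m))" "j < dim_col (0\<^sub>m 1 (e * m))"
  hence i: "i = 0" and j: "j < e * m" by auto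
  hence m: "0 < m" by (auto intro: Nat.gr0I)
  define l b where "l = j div m" and "b = j mod m"
  have lb: "l < e" "b < m" using j m by (auto simp: l_def b_def less_mult_imp_div_less)
  have s: "stack_vec n w \<in> carrier_vec (n * m)" using w by (simp add: stack_vec_def)
  have "(mat_of_rows (n * m) [stack_vec n w] * (E \<otimes>\<^sub>K 1\<^sub>m m)) $$ (i,j) =
      (\<Sum>k<n * m. w $ (k mod m) * (E $$ (k div m, l) * (if k mod m = b then 1 else 0)))"
    using E w s i j lb m
    by (simp add: scalar_prod_def atLeast0LessThan stack_vec_def kronecker_mat_def l_def b_def
        less_mult_imp_div_less)
  also have "\<dots> = (\<Sum>x<n. \<Sum>y<m. w $ y * (E $$ (x, l) * (if y = b then 1 else 0)))"
    by (rule sum_div_mod)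
  also have "\<dots> = (\<Sum>x<n. w $ b * E $$ (x, l))"
    using lb by (intro sum.cong refl) (simp add: if_distrib cong: if_cong)
  also have "\<dots> = 0" using sum[OF lb(1)] by (simp flip: sum_distrib_left)
  finally show "(mat_of_rows (n * m) [stack_vec n w] * (E \<otimes>\<^sub>K 1\<^sub>m m)) $$ (i,j) = 0\<^sub>m 1 (e * m) $$ (i,j)"
    using i j by simp
qed (use E in auto)

text \<open>As head and tail differ, the nested conditional is a difference of two indicators; a
  loop would leave a single 1 in its column.\<close>

lemma incidence_mat_col_sum:
  assumes "loopfree_digraph \<G>" "verts \<G> = {..<n}" "j \<in> arcs \<G>" "j < e"
  shows "(\<Sum>i<n. incidence_mat \<G> n e $$ (i,j)) = 0"
proof -
  interpret loopfree_digraph \<G> by fact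
  define h t where "h = head \<G> j" and "t = tail \<G> j"
  have ht: "h < n" "t < n" "t \<noteq> h"
    using assms head_in_verts[of j] tail_in_verts[of j] no_loops[of j] by (auto simp: h_def t_def)
  have "(\<Sum>i<n. incidence_mat \<G> n e $$ (i,j)) = (\<Sum>i<n. (if i = h then 1 else 0) - (if i = t then 1 else 0))"
    using assms(4) ht by (intro sum.cong) (auto simp: incidence_mat_def h_def t_def)
  also have "\<dots> = 0" using ht by (simp add: sum_subtractf)
  finally show ?thesis .
qed

text \<open>All agents share the direction \<open>w\<close>, and a stack of equal blocks is annihilated by
  \<open>E \<otimes> I\<close> because the columns of an incidence matrix sum to zero.\<close>

lemma network_cancellation:
  assumes dir: "\<And>G. G \<in> set Gs \<Longrightarrow> G \<in> carrier_mat p m \<and> input_direction G z w"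
    and w: "w \<in> carrier_vec m" "w \<noteq> 0\<^sub>v m" and n: "length Gs = n" "0 < n"
    and E: "E \<in> carrier_mat n e" "\<And>j. j < e \<Longrightarrow> (\<Sum>i<n. E $$ (i,j)) = 0"
    and K: "K = tf_const (E \<otimes>\<^sub>K 1\<^sub>m m) * M" "dim_row M = e * m" "realizable K"
  shows "pole_mult (diag_block_mat Gs * K) z < pole_mult (diag_block_mat Gs) z + pole_mult K z"
proof (rule cascade_cancellation)
  show "input_direction (diag_block_mat Gs) z (stack_vec n w)"
    using input_direction_diag_block_mat[of Gs z w] dir n by auto
  show "stack_vec n w \<noteq> 0\<^sub>v (n * m)"
  proof
    assume 0: "stack_vec n w = 0\<^sub>v (n * m)"
    \<comment> \<open>Since \<open>n\<close> is positive, the stack has a first block, and this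
      block is \<open>w\<close>.\<close>
    have "w $ i = 0" if "i < m" for i
    proof -
      have "i < n * m" using that n(2) by (metis One_nat_def Suc_leI le_trans mult_le_mono1 nat_mult_1 not_le)
      thus ?thesis using arg_cong[OF 0, of "\<lambda>v. v $ i"] that w by (simp add: stack_vec_def)
    qed
    hence "w = 0\<^sub>v m" using w by (auto intro!: eq_vecI)
    thus False using w by simp
  qed
  show "dim_col (diag_block_mat Gs) = n * m"
  proof -
    have "diag_block_mat Gs \<in> carrier_mat (length Gs * p) (length Gs * m)"
      by (rule diag_block_mat_carrier) (use dir in blast)
    thus ?thesis using n by simp
  qed
  show "dim_row K = n * m" using K E by simp
  let ?W = "mat_of_rows (n * m) [stack_vec n w]"
  have "tf_const ?W * K = tf_const (?W * (E \<otimes>\<^sub>K 1\<^sub>m m)) * M"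
    unfolding K(1) using K(2) E by (simp add: tf_const_mult mult_assoc_mat)
  also have "\<dots> = 0\<^sub>m 1 (dim_col K)"
  proof -
    have "M \<in> carrier_mat (e * m) (dim_col K)" by (rule carrier_matI) (simp_all add: K(1,2))
    moreover have "?W * (E \<otimes>\<^sub>K 1\<^sub>m m) = 0\<^sub>m 1 (e * m)"
      by (rule stack_vec_kronecker_one[OF E w(1)])
    ultimately show ?thesis by simp
  qed
  finally show "tf_const ?W * K = 0\<^sub>m 1 (dim_col K)" .
qed fact

theorem proposition4p3:
  fixes \<G> :: "(nat, nat) pre_digraph"
    and \<nu> \<mu> m p :: nat
    and Pi Ke_blk :: "nat \<Rightarrow> tf"
    and P Ke K E :: tf
    and lam :: complex
  assumes graph: "loopfree_digraph \<G>" "verts \<G> = {..<\<nu>}" "arcs \<G> = {..<\<mu>}"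
    and Pi_dim: "\<And>i. i < \<nu> \<Longrightarrow> Pi i \<in> carrier_mat p m"
    and Ke_dim: "\<And>j. j < \<mu> \<Longrightarrow> Ke_blk j \<in> carrier_mat m p"
    and P: "P = diag_block_mat (map Pi [0..<\<nu>])"
    and Ke: "Ke = diag_block_mat (map Ke_blk [0..<\<mu>])"
    and E: "E = tf_const (map_mat complex_of_real (incidence_mat \<G> \<nu> \<mu>))"
    and K: "K = (E \<otimes>\<^sub>K 1\<^sub>m m) * Ke * (transpose_mat E \<otimes>\<^sub>K 1\<^sub>m p)"
    and P_real_proper: "tf_real P" "tf_proper P"
    and Ke_real_proper: "tf_real Ke" "tf_proper Ke"
    and pole: "0 \<le> Re lam" "tf_pole P lam"
  shows "((\<Inter>i<\<nu>. pdir_i (Pi i) lam) \<noteq> {0\<^sub>v m} \<longrightarrow> canceled lam P K) \<and>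
         ((\<Inter>i<\<nu>. pdir_o (Pi i) lam) \<noteq> {0\<^sub>v p} \<longrightarrow> canceled lam K P)"
proof -
  define N where "N = map_mat complex_of_real (incidence_mat \<G> \<nu> \<mu>)"
  have N: "N \<in> carrier_mat \<nu> \<mu>" by (simp add: N_def incidence_mat_def)
  have N_sum: "(\<Sum>i<\<nu>. N $$ (i,j)) = 0" if "j < \<mu>" for j
  proof -
    have "(\<Sum>i<\<nu>. N $$ (i,j)) = complex_of_real (\<Sum>i<\<nu>. incidence_mat \<G> \<nu> \<mu> $$ (i,j))"
      unfolding of_real_sum using that by (intro sum.cong) (simp_all add: N_def incidence_mat_def)
    thus ?thesis using incidence_mat_col_sum[OF graph(1,2)] that graph(3) by simp
  qed
  have kron: "E \<otimes>\<^sub>K 1\<^sub>m k = tf_const (N \<otimes>\<^sub>K 1\<^sub>m k)"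
    "transpose_mat E \<otimes>\<^sub>K 1\<^sub>m k = tf_const (transpose_mat N \<otimes>\<^sub>K 1\<^sub>m k)" for k
    by (simp_all add: E N_def[symmetric] tf_const_kronecker tf_const_transpose)
  have dP: "P \<in> carrier_mat (\<nu> * p) (\<nu> * m)"
  proof -
    have "P \<in> carrier_mat (length (map Pi [0..<\<nu>]) * p) (length (map Pi [0..<\<nu>]) * m)"
      unfolding P by (rule diag_block_mat_carrier) (use Pi_dim in auto)
    thus ?thesis by simp
  qed
  have dKe: "Ke \<in> carrier_mat (\<mu> * m) (\<mu> * p)"
  proof -
    have "Ke \<in> carrier_mat (length (map Ke_blk [0..<\<mu>]) * m) (length (map Ke_blk [0..<\<mu>]) * p)"
      unfolding Ke by (rule diag_block_mat_carrier) (use Ke_dim in auto)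
    thus ?thesis by simp
  qed
  have dK: "K \<in> carrier_mat (\<nu> * m) (\<nu> * p)" unfolding K kron using N by (auto intro!: carrier_matI)
  have rP: "realizable P" using P_real_proper by (intro realizable_proper)
  \<comment> \<open>\<open>K\<close> is a product of constant matrices and the proper
    \<open>Ke\<close>, so it is realizable without a separate check that its entries are
    proper.\<close>
  have rK: "realizable K" unfolding K kron
    using N dKe realizable_proper[OF Ke_real_proper(2)]
    by (intro realizable_mult realizable_const) auto
  have rPi: "realizable (Pi i)" if "i < \<nu>" for i
    using that by (intro realizable_proper tf_proper_diag_block[OF P_real_proper(2)[unfolded P]]) simp
  \<comment> \<open>With no nodes the intersections would run over an empty family and contain every
    vector; but then \<open>P\<close> is the empty matrix, which has a realization without states
    and hence no pole.\<close>
  have "0 < \<nu>"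
  proof (rule ccontr)
    assume "\<not> 0 < \<nu>"
    hence "P = tf_const (0\<^sub>m 0 0)" by (simp add: P)
    hence "pole_mult P lam \<le> order lam (char_poly (0\<^sub>m 0 0))"
      using pole_mult_le[OF realization_const[of "0\<^sub>m 0 0"]] by simp
    also have "char_poly (0\<^sub>m 0 0 :: complex mat) = 1" by (simp add: char_poly_def char_poly_matrix_def)
    finally show False using pole(2) tf_pole_iff[OF rP] by (simp add: order_0I)
  qed
  have "canceled lam P K" if ne: "(\<Inter>i<\<nu>. pdir_i (Pi i) lam) \<noteq> {0\<^sub>v m}"
  proof -
    have "0\<^sub>v m \<in> (\<Inter>i<\<nu>. pdir_i (Pi i) lam)" using pdir_i_dim(1)[OF rPi Pi_dim] by auto
    then obtain u where u: "u \<in> (\<Inter>i<\<nu>. pdir_i (Pi i) lam)" "u \<noteq> 0\<^sub>v m" using ne by blast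
    have um: "u \<in> carrier_vec m" using u(1) \<open>0 < \<nu>\<close> pdir_i_dim(2)[OF rPi Pi_dim] by blast
    have "pole_mult (P * K) lam < pole_mult P lam + pole_mult K lam"
      unfolding P
    proof (rule network_cancellation)
      show "G \<in> carrier_mat p m \<and> input_direction G lam (conjugate u)"
        if "G \<in> set (map Pi [0..<\<nu>])" for G
        using that pdir_i_input_direction rPi Pi_dim u(1) by auto
      show "K = tf_const (N \<otimes>\<^sub>K 1\<^sub>m m) * (Ke * (transpose_mat E \<otimes>\<^sub>K 1\<^sub>m p))"
        unfolding K kron using N dKe by (intro mult_assoc_mat) auto
      show "conjugate u \<noteq> 0\<^sub>v m"
        using u(2) by (metis conjugate_id conjugate_zero_vec)
      show "\<And>j. j < \<mu> \<Longrightarrow> (\<Sum>i<\<nu>. N $$ (i,j)) = 0" by (rule N_sum)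
    qed (use N um \<open>0 < \<nu>\<close> dKe rK in auto)
    thus ?thesis using pole by (simp add: canceled_def add.commute)
  qed
  moreover have "canceled lam K P" if ne: "(\<Inter>i<\<nu>. pdir_o (Pi i) lam) \<noteq> {0\<^sub>v p}"
  proof -
    have "0\<^sub>v p \<in> (\<Inter>i<\<nu>. pdir_o (Pi i) lam)" using pdir_o_dim(1)[OF rPi Pi_dim] by auto
    then obtain u where u: "u \<in> (\<Inter>i<\<nu>. pdir_o (Pi i) lam)" "u \<noteq> 0\<^sub>v p" using ne by blast
    have up: "u \<in> carrier_vec p" using u(1) \<open>0 < \<nu>\<close> pdir_o_dim(2)[OF rPi Pi_dim] by blast
    let ?Gs = "map transpose_mat (map Pi [0..<\<nu>])"
    have PT: "transpose_mat P = diag_block_mat ?Gs" unfolding P by (rule diag_block_mat_transpose)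
    have "pole_mult (transpose_mat P * transpose_mat K) lam < pole_mult (transpose_mat P) lam + pole_mult (transpose_mat K) lam"
      unfolding PT
    proof (rule network_cancellation)
      show "G \<in> carrier_mat m p \<and> input_direction G lam u" if "G \<in> set ?Gs" for G
        using that pdir_o_input_direction rPi Pi_dim u(1) by auto
      \<comment> \<open>The transposed controller has the same structure, with \<open>m\<close> and
        \<open>p\<close> exchanged and \<open>Ke\<close> transposed, so the incidence matrix again
        stands on the left.\<close>
      show "transpose_mat K = tf_const (N \<otimes>\<^sub>K 1\<^sub>m p) * (transpose_mat Ke * (transpose_mat E \<otimes>\<^sub>K 1\<^sub>m m))"
        unfolding K kron using N dKe
        by (simp add: transpose_mult_mat tf_const_transpose[symmetric] transpose_kronecker)
      show "realizable (transpose_mat K)" by (rule realizable_transpose[OF rK])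
      show "\<And>j. j < \<mu> \<Longrightarrow> (\<Sum>i<\<nu>. N $$ (i,j)) = 0" by (rule N_sum)
    qed (use N up u(2) \<open>0 < \<nu>\<close> dKe in auto)
    moreover have "transpose_mat P * transpose_mat K = transpose_mat (K * P)"
      using dP dK by (simp add: transpose_mult_mat)
    moreover have "realizable (K * P)" using realizable_mult[OF rK rP] dP dK by simp
    ultimately have "pole_mult (K * P) lam < pole_mult P lam + pole_mult K lam"
      using pole_mult_transpose rP rK by simp
    thus ?thesis using pole by (simp add: canceled_def)
  qed
  ultimately show ?thesis by blast
qed

end
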